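(* For every integral connectivity space $X$, the endofunctor $X\boxtimes -$ of $\mathbf{Cnct}$ is left adjoint to the endofunctor $\mathbf{Cnct}(X,-)$. Thus $(\mathbf{Cnct},\boxtimes)$ is a closed symmetric monoidal category.
   Context: A connectivity structure on a set $X$ is a set $\mathcal{K}$ of subsets of $X$ with $\emptyset\in\mathcal{K}$ such that for every $\mathcal{I}\subseteq\mathcal{K}$, if $\bigcap_{K\in\mathcal{I}}K\neq\emptyset$ then $\bigcup_{K\in\mathcal{I}}K\in\mathcal{K}$. A connectivity space $X=(|X|,\kappa(X))$ is a set $|X|$ with a connectivity structure $\kappa(X)$ on it; it is integral if every singleton of $|X|$ belongs to $\kappa(X)$. A connectivity morphism $X\to Y$ is a function $f:|X|\to|Y|$ with $f(K)\in\kappa(Y)$ for all $K\in\kappa(X)$; $Hom(X,Y)$ is the set of these. $\mathbf{Cnct}$ is the category of integral connectivity spaces and connectivity morphisms. For a set $\mathcal{A}$ of subsets of a set, $[\mathcal{A}]_0$ denotes the smallest (for inclusion) connectivity structure containing $\mathcal{A}$. Tensor product: $X_1\boxtimes X_2$ has carrier $|X_1|\times|X_2|$ and $\kappa(X_1\boxtimes X_2)=[\{K_1\times K_2: K_1\in\kappa(X_1),K_2\in\kappa(X_2)\}]_0$. For a morphism $g:Y_1\to Y_2$, $(X\boxtimes g)(x,y)=(x,g(y))$. Internal hom: $\mathbf{Cnct}(X,Y)$ has carrier $Hom(X,Y)$, and a set $M\subseteq Hom(X,Y)$ belongs to $\kappa(\mathbf{Cnct}(X,Y))$ iff $\bigcup_{f\in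 M}f(K)\in\kappa(Y)$ for all $K\in\kappa(X)$. For a morphism $g:Y_1\to Y_2$, $\mathbf{Cnct}(X,g)(\varphi)=g\circ\varphi$. *)

theory Defs
  imports "HOL-Library.FuncSet"
begin

section \<open>Integral connectivity spaces\<close>

record 'a cspace =
  points :: "'a set"
  conn :: "'a set set"

text \<open>For the empty family the intersection is \<open>UNIV\<close>, so the condition asks for
  the empty set only, which is required anyway.\<close>

definition connectivity_structure :: "'a set \<Rightarrow> 'a set set \<Rightarrow> bool" where
  "connectivity_structure S \<K> \<longleftrightarrow>
     \<K> \<subseteq> Pow S \<and> {} \<in> \<K> \<and> (\<forall>\<I>\<subseteq>\<K>. \<Inter>\<I> \<noteq> {} \<longrightarrow> \<Union>\<I> \<in> \<K>)"

definition connectivity_space :: "'a cspace \<Rightarrow> bool" where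
  "connectivity_space X \<longleftrightarrow> connectivity_structure (points X) (conn X)"

definition integral_cspace :: "'a cspace \<Rightarrow> bool" where
  "integral_cspace X \<longleftrightarrow> connectivity_space X \<and> (\<forall>x\<in>points X. {x} \<in> conn X)"

definition generated :: "'a set \<Rightarrow> 'a set set \<Rightarrow> 'a set set" where
  "generated S \<A> = \<Inter>{\<K>. connectivity_structure S \<K> \<and> \<A> \<subseteq> \<K>}"

lemma connectivity_structure_generated:
  assumes "\<A> \<subseteq> Pow S"
  shows "connectivity_structure S (generated S \<A>)"
proof -
  have "connectivity_structure S (Pow S)"
    unfolding connectivity_structure_def by blast
  then have "generated S \<A> \<subseteq> Pow S"
    using assms unfolding generated_def by blast
  moreover have "{} \<in> generated S \<A>"
    unfolding generated_def connectivity_structure_def by blast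
  moreover have "\<Union>\<I> \<in> generated S \<A>" if "\<I> \<subseteq> generated S \<A>" "\<Inter>\<I> \<noteq> {}" for \<I>
    unfolding generated_def
  proof (rule InterI)
    fix \<K> assume "\<K> \<in> {\<K>. connectivity_structure S \<K> \<and> \<A> \<subseteq> \<K>}"
    moreover from this have "\<I> \<subseteq> \<K>"
      using that(1) unfolding generated_def by blast
    ultimately show "\<Union>\<I> \<in> \<K>"
      using that(2) unfolding connectivity_structure_def by blast
  qed
  ultimately show ?thesis
    unfolding connectivity_structure_def by blast
qed

lemma generated_superset: "\<A> \<subseteq> generated S \<A>"
  unfolding generated_def by blast

lemma generated_least:
  "connectivity_structure S \<K> \<Longrightarrow> \<A> \<subseteq> \<K> \<Longrightarrow> generated S \<A> \<subseteq> \<K>"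
  unfolding generated_def by blast

text \<open>Morphisms are extensional functions, so that equality of morphisms is equality in HOL.
  Composition of \<open>f \<in> chom X Y\<close> with \<open>g \<in> chom Y Z\<close> is \<open>compose (points X) g f\<close>.\<close>

definition chom :: "'a cspace \<Rightarrow> 'b cspace \<Rightarrow> ('a \<Rightarrow> 'b) set" where
  "chom X Y = {f \<in> points X \<rightarrow>\<^sub>E points Y. \<forall>K\<in>conn X. f ` K \<in> conn Y}"

definition cid :: "'a cspace \<Rightarrow> 'a \<Rightarrow> 'a" where
  "cid X = (\<lambda>x\<in>points X. x)"

definition ciso :: "'a cspace \<Rightarrow> 'b cspace \<Rightarrow> ('a \<Rightarrow> 'b) \<Rightarrow> bool" where
  "ciso X Y f \<longleftrightarrow> f \<in> chom X Y \<and>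
     (\<exists>g\<in>chom Y X. compose (points X) g f = cid X \<and> compose (points Y) f g = cid Y)"

definition tensor :: "'a cspace \<Rightarrow> 'b cspace \<Rightarrow> ('a \<times> 'b) cspace" (infixr \<open>\<boxtimes>\<close> 75) where
  "X \<boxtimes> Y = \<lparr>points = points X \<times> points Y,
     conn = generated (points X \<times> points Y) {K \<times> L | K L. K \<in> conn X \<and> L \<in> conn Y}\<rparr>"

definition tensor_map ::
  "'a cspace \<Rightarrow> 'b cspace \<Rightarrow> ('a \<Rightarrow> 'c) \<Rightarrow> ('b \<Rightarrow> 'd) \<Rightarrow> 'a \<times> 'b \<Rightarrow> 'c \<times> 'd" where
  "tensor_map X Y f g = (\<lambda>(x, y)\<in>points X \<times> points Y. (f x, g y))"

definition tensor_left ::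
  "'a cspace \<Rightarrow> 'b cspace \<Rightarrow> ('b \<Rightarrow> 'c) \<Rightarrow> 'a \<times> 'b \<Rightarrow> 'a \<times> 'c" where
  "tensor_left X Y g = (\<lambda>(x, y)\<in>points X \<times> points Y. (x, g y))"

definition ihom :: "'a cspace \<Rightarrow> 'b cspace \<Rightarrow> ('a \<Rightarrow> 'b) cspace" where
  "ihom X Y = \<lparr>points = chom X Y,
     conn = {M. M \<subseteq> chom X Y \<and> (\<forall>K\<in>conn X. (\<Union>f\<in>M. f ` K) \<in> conn Y)}\<rparr>"

definition ihom_map ::
  "'a cspace \<Rightarrow> 'b cspace \<Rightarrow> ('b \<Rightarrow> 'c) \<Rightarrow> ('a \<Rightarrow> 'b) \<Rightarrow> 'a \<Rightarrow> 'c" where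
  "ihom_map X Y g = (\<lambda>\<phi>\<in>chom X Y. compose (points X) g \<phi>)"

definition transpose ::
  "'a cspace \<Rightarrow> 'b cspace \<Rightarrow> ('a \<times> 'b \<Rightarrow> 'c) \<Rightarrow> 'b \<Rightarrow> 'a \<Rightarrow> 'c" where
  "transpose X Y f = (\<lambda>y\<in>points Y. \<lambda>x\<in>points X. f (x, y))"

definition point_cspace :: "'a \<Rightarrow> 'a cspace" where
  "point_cspace p = \<lparr>points = {p}, conn = {{}, {p}}\<rparr>"

abbreviation one_cspace :: "unit cspace" where
  "one_cspace \<equiv> point_cspace ()"

definition associator ::
  "'a cspace \<Rightarrow> 'b cspace \<Rightarrow> 'c cspace \<Rightarrow> ('a \<times> 'b) \<times> 'c \<Rightarrow> 'a \<times> 'b \<times> 'c" where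
  "associator X Y Z = (\<lambda>((x, y), z)\<in>points ((X \<boxtimes> Y) \<boxtimes> Z). (x, y, z))"

definition left_unitor :: "'a cspace \<Rightarrow> unit \<times> 'a \<Rightarrow> 'a" where
  "left_unitor X = (\<lambda>(u, x)\<in>points (one_cspace \<boxtimes> X). x)"

definition right_unitor :: "'a cspace \<Rightarrow> 'a \<times> unit \<Rightarrow> 'a" where
  "right_unitor X = (\<lambda>(x, u)\<in>points (X \<boxtimes> one_cspace). x)"

definition braiding :: "'a cspace \<Rightarrow> 'b cspace \<Rightarrow> 'a \<times> 'b \<Rightarrow> 'b \<times> 'a" where
  "braiding X Y = (\<lambda>(x, y)\<in>points (X \<boxtimes> Y). (y, x))"


section \<open>The closed symmetric monoidal structure, type by type\<close>

text \<open>Objects are connectivity spaces over arbitrary HOL types. Since a formula cannot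
  quantify over types, each axiom is stated for given objects, whose types are free.\<close>

definition cnct_category_laws ::
  "'a cspace \<Rightarrow> 'b cspace \<Rightarrow> 'c cspace \<Rightarrow> 'd cspace \<Rightarrow> bool" where
  "cnct_category_laws W X Y Z \<longleftrightarrow>
     cid W \<in> chom W W \<and>
     (\<forall>f\<in>chom W X. compose (points W) f (cid W) = f \<and> compose (points W) (cid X) f = f) \<and>
     (\<forall>f\<in>chom W X. \<forall>g\<in>chom X Y. compose (points W) g f \<in> chom W Y) \<and>
     (\<forall>f\<in>chom W X. \<forall>g\<in>chom X Y. \<forall>h\<in>chom Y Z.
        compose (points W) h (compose (points W) g f) =
        compose (points W) (compose (points X) h g) f)"

definition tensor_functor_laws ::
  "'a cspace \<Rightarrow> 'b cspace \<Rightarrow> 'c cspace \<Rightarrow> 'd cspace \<Rightarrow> 'e cspace \<Rightarrow> 'f cspace \<Rightarrow> bool" where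
  "tensor_functor_laws X X' X'' Y Y' Y'' \<longleftrightarrow>
     integral_cspace (X \<boxtimes> Y) \<and>
     (\<forall>f\<in>chom X X'. \<forall>g\<in>chom Y Y'. tensor_map X Y f g \<in> chom (X \<boxtimes> Y) (X' \<boxtimes> Y')) \<and>
     tensor_map X Y (cid X) (cid Y) = cid (X \<boxtimes> Y) \<and>
     (\<forall>f\<in>chom X X'. \<forall>f'\<in>chom X' X''. \<forall>g\<in>chom Y Y'. \<forall>g'\<in>chom Y' Y''.
        tensor_map X Y (compose (points X) f' f) (compose (points Y) g' g) =
        compose (points (X \<boxtimes> Y)) (tensor_map X' Y' f' g') (tensor_map X Y f g))"

definition tensor_left_functor_laws ::
  "'a cspace \<Rightarrow> 'b cspace \<Rightarrow> 'c cspace \<Rightarrow> 'd cspace \<Rightarrow> bool" where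
  "tensor_left_functor_laws X Y Y' Y'' \<longleftrightarrow>
     integral_cspace (X \<boxtimes> Y) \<and>
     (\<forall>g\<in>chom Y Y'. tensor_left X Y g \<in> chom (X \<boxtimes> Y) (X \<boxtimes> Y')) \<and>
     tensor_left X Y (cid Y) = cid (X \<boxtimes> Y) \<and>
     (\<forall>g\<in>chom Y Y'. \<forall>g'\<in>chom Y' Y''.
        tensor_left X Y (compose (points Y) g' g) =
        compose (points (X \<boxtimes> Y)) (tensor_left X Y' g') (tensor_left X Y g))"

definition ihom_functor_laws ::
  "'a cspace \<Rightarrow> 'b cspace \<Rightarrow> 'c cspace \<Rightarrow> 'd cspace \<Rightarrow> bool" where
  "ihom_functor_laws X Y Y' Y'' \<longleftrightarrow>
     integral_cspace (ihom X Y) \<and>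
     (\<forall>g\<in>chom Y Y'. ihom_map X Y g \<in> chom (ihom X Y) (ihom X Y')) \<and>
     ihom_map X Y (cid Y) = cid (ihom X Y) \<and>
     (\<forall>g\<in>chom Y Y'. \<forall>g'\<in>chom Y' Y''.
        ihom_map X Y (compose (points Y) g' g) =
        compose (points (ihom X Y)) (ihom_map X Y' g') (ihom_map X Y g))"

definition tensor_ihom_adjunction ::
  "'a cspace \<Rightarrow> 'b cspace \<Rightarrow> 'c cspace \<Rightarrow> 'd cspace \<Rightarrow> 'e cspace \<Rightarrow> bool" where
  "tensor_ihom_adjunction X Y Y' Z Z' \<longleftrightarrow>
     bij_betw (transpose X Y) (chom (X \<boxtimes> Y) Z) (chom Y (ihom X Z)) \<and>
     (\<forall>g\<in>chom Y' Y. \<forall>h\<in>chom Z Z'. \<forall>f\<in>chom (X \<boxtimes> Y) Z.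
        transpose X Y' (compose (points (X \<boxtimes> Y')) h
          (compose (points (X \<boxtimes> Y')) f (tensor_left X Y' g))) =
        compose (points Y') (ihom_map X Z h) (compose (points Y') (transpose X Y f) g))"

definition associator_laws ::
  "'a cspace \<Rightarrow> 'b cspace \<Rightarrow> 'c cspace \<Rightarrow> 'd cspace \<Rightarrow> 'e cspace \<Rightarrow> 'f cspace \<Rightarrow> bool" where
  "associator_laws X X' Y Y' Z Z' \<longleftrightarrow>
     ciso ((X \<boxtimes> Y) \<boxtimes> Z) (X \<boxtimes> (Y \<boxtimes> Z)) (associator X Y Z) \<and>
     (\<forall>f\<in>chom X X'. \<forall>g\<in>chom Y Y'. \<forall>h\<in>chom Z Z'.
        compose (points ((X \<boxtimes> Y) \<boxtimes> Z)) (associator X' Y' Z')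
          (tensor_map (X \<boxtimes> Y) Z (tensor_map X Y f g) h) =
        compose (points ((X \<boxtimes> Y) \<boxtimes> Z)) (tensor_map X (Y \<boxtimes> Z) f (tensor_map Y Z g h))
          (associator X Y Z))"

definition unitor_laws :: "'a cspace \<Rightarrow> 'b cspace \<Rightarrow> bool" where
  "unitor_laws X X' \<longleftrightarrow>
     integral_cspace one_cspace \<and>
     ciso (one_cspace \<boxtimes> X) X (left_unitor X) \<and>
     ciso (X \<boxtimes> one_cspace) X (right_unitor X) \<and>
     (\<forall>f\<in>chom X X'.
        compose (points (one_cspace \<boxtimes> X)) (left_unitor X')
          (tensor_map one_cspace X (cid one_cspace) f) =
        compose (points (one_cspace \<boxtimes> X)) f (left_unitor X) \<and>
        compose (points (X \<boxtimes> one_cspace)) (right_unitor X')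
          (tensor_map X one_cspace f (cid one_cspace)) =
        compose (points (X \<boxtimes> one_cspace)) f (right_unitor X))"

definition braiding_laws ::
  "'a cspace \<Rightarrow> 'b cspace \<Rightarrow> 'c cspace \<Rightarrow> 'd cspace \<Rightarrow> bool" where
  "braiding_laws X X' Y Y' \<longleftrightarrow>
     ciso (X \<boxtimes> Y) (Y \<boxtimes> X) (braiding X Y) \<and>
     (\<forall>f\<in>chom X X'. \<forall>g\<in>chom Y Y'.
        compose (points (X \<boxtimes> Y)) (braiding X' Y') (tensor_map X Y f g) =
        compose (points (X \<boxtimes> Y)) (tensor_map Y X g f) (braiding X Y)) \<and>
     compose (points (X \<boxtimes> Y)) (braiding Y X) (braiding X Y) = cid (X \<boxtimes> Y)"

definition pentagon_law ::
  "'a cspace \<Rightarrow> 'b cspace \<Rightarrow> 'c cspace \<Rightarrow> 'd cspace \<Rightarrow> bool" where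
  "pentagon_law W X Y Z \<longleftrightarrow>
     (let P = points (((W \<boxtimes> X) \<boxtimes> Y) \<boxtimes> Z) in
        compose P (associator W X (Y \<boxtimes> Z)) (associator (W \<boxtimes> X) Y Z) =
        compose P (tensor_map W ((X \<boxtimes> Y) \<boxtimes> Z) (cid W) (associator X Y Z))
          (compose P (associator W (X \<boxtimes> Y) Z)
            (tensor_map ((W \<boxtimes> X) \<boxtimes> Y) Z (associator W X Y) (cid Z))))"

definition triangle_law :: "'a cspace \<Rightarrow> 'b cspace \<Rightarrow> bool" where
  "triangle_law X Y \<longleftrightarrow>
     compose (points ((X \<boxtimes> one_cspace) \<boxtimes> Y))
       (tensor_map X (one_cspace \<boxtimes> Y) (cid X) (left_unitor Y)) (associator X one_cspace Y) =
     tensor_map (X \<boxtimes> one_cspace) Y (right_unitor X) (cid Y)"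

definition hexagon_law :: "'a cspace \<Rightarrow> 'b cspace \<Rightarrow> 'c cspace \<Rightarrow> bool" where
  "hexagon_law X Y Z \<longleftrightarrow>
     (let P = points ((X \<boxtimes> Y) \<boxtimes> Z) in
        compose P (associator Y Z X) (compose P (braiding X (Y \<boxtimes> Z)) (associator X Y Z)) =
        compose P (tensor_map Y (X \<boxtimes> Z) (cid Y) (braiding X Z))
          (compose P (associator Y X Z) (tensor_map (X \<boxtimes> Y) Z (braiding X Y) (cid Z))))"


section \<open>Categories, adjunctions, closed symmetric monoidal categories\<close>

text \<open>Hom-sets need not be disjoint, so composition and the action of functors on morphisms
  take the objects as arguments: \<open>cat_comp C A B D g f\<close> is \<open>g\<close> after \<open>f\<close> for
  \<open>f\<close> from \<open>A\<close> to \<open>B\<close> and \<open>g\<close> from \<open>B\<close> to \<open>D\<close>.\<close>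

record ('o, 'm) cat =
  cat_ob :: "'o set"
  cat_hom :: "'o \<Rightarrow> 'o \<Rightarrow> 'm set"
  cat_comp :: "'o \<Rightarrow> 'o \<Rightarrow> 'o \<Rightarrow> 'm \<Rightarrow> 'm \<Rightarrow> 'm"
  cat_id :: "'o \<Rightarrow> 'm"

definition category :: "('o, 'm) cat \<Rightarrow> bool" where
  "category C \<longleftrightarrow>
     (\<forall>A\<in>cat_ob C. cat_id C A \<in> cat_hom C A A) \<and>
     (\<forall>A\<in>cat_ob C. \<forall>B\<in>cat_ob C. \<forall>f\<in>cat_hom C A B.
        cat_comp C A A B f (cat_id C A) = f \<and> cat_comp C A B B (cat_id C B) f = f) \<and>
     (\<forall>A\<in>cat_ob C. \<forall>B\<in>cat_ob C. \<forall>D\<in>cat_ob C. \<forall>f\<in>cat_hom C A B. \<forall>g\<in>cat_hom C B D.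
        cat_comp C A B D g f \<in> cat_hom C A D) \<and>
     (\<forall>A\<in>cat_ob C. \<forall>B\<in>cat_ob C. \<forall>D\<in>cat_ob C. \<forall>E\<in>cat_ob C.
        \<forall>f\<in>cat_hom C A B. \<forall>g\<in>cat_hom C B D. \<forall>h\<in>cat_hom C D E.
        cat_comp C A D E h (cat_comp C A B D g f) =
        cat_comp C A B E (cat_comp C B D E h g) f)"

definition cat_iso :: "('o, 'm) cat \<Rightarrow> 'o \<Rightarrow> 'o \<Rightarrow> 'm \<Rightarrow> bool" where
  "cat_iso C A B f \<longleftrightarrow> f \<in> cat_hom C A B \<and>
     (\<exists>g\<in>cat_hom C B A. cat_comp C A B A g f = cat_id C A \<and> cat_comp C B A B f g = cat_id C B)"

definition prod_cat :: "('o, 'm) cat \<Rightarrow> ('p, 'n) cat \<Rightarrow> ('o \<times> 'p, 'm \<times> 'n) cat" where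
  "prod_cat C D = \<lparr>cat_ob = cat_ob C \<times> cat_ob D,
     cat_hom = (\<lambda>(A, B) (A', B'). cat_hom C A A' \<times> cat_hom D B B'),
     cat_comp = (\<lambda>(A, B) (A', B') (A'', B'') (f', g') (f, g).
       (cat_comp C A A' A'' f' f, cat_comp D B B' B'' g' g)),
     cat_id = (\<lambda>(A, B). (cat_id C A, cat_id D B))\<rparr>"

record ('o, 'm, 'p, 'n) fctr =
  fob :: "'o \<Rightarrow> 'p"
  fmap :: "'o \<Rightarrow> 'o \<Rightarrow> 'm \<Rightarrow> 'n"

definition is_functor ::
  "('o, 'm) cat \<Rightarrow> ('p, 'n) cat \<Rightarrow> ('o, 'm, 'p, 'n) fctr \<Rightarrow> bool" where
  "is_functor C D F \<longleftrightarrow>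
     (\<forall>A\<in>cat_ob C. fob F A \<in> cat_ob D) \<and>
     (\<forall>A\<in>cat_ob C. \<forall>B\<in>cat_ob C. \<forall>f\<in>cat_hom C A B.
        fmap F A B f \<in> cat_hom D (fob F A) (fob F B)) \<and>
     (\<forall>A\<in>cat_ob C. fmap F A A (cat_id C A) = cat_id D (fob F A)) \<and>
     (\<forall>A\<in>cat_ob C. \<forall>B\<in>cat_ob C. \<forall>E\<in>cat_ob C. \<forall>f\<in>cat_hom C A B. \<forall>g\<in>cat_hom C B E.
        fmap F A E (cat_comp C A B E g f) =
        cat_comp D (fob F A) (fob F B) (fob F E) (fmap F B E g) (fmap F A B f))"

definition natural_iso ::
  "('o, 'm) cat \<Rightarrow> ('p, 'n) cat \<Rightarrow> ('o, 'm, 'p, 'n) fctr \<Rightarrow> ('o, 'm, 'p, 'n) fctr \<Rightarrow>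
   ('o \<Rightarrow> 'n) \<Rightarrow> bool" where
  "natural_iso C D F G \<tau> \<longleftrightarrow>
     (\<forall>A\<in>cat_ob C. cat_iso D (fob F A) (fob G A) (\<tau> A)) \<and>
     (\<forall>A\<in>cat_ob C. \<forall>B\<in>cat_ob C. \<forall>f\<in>cat_hom C A B.
        cat_comp D (fob F A) (fob F B) (fob G B) (\<tau> B) (fmap F A B f) =
        cat_comp D (fob F A) (fob G A) (fob G B) (fmap G A B f) (\<tau> A))"

definition left_adjoint ::
  "('o, 'm) cat \<Rightarrow> ('p, 'n) cat \<Rightarrow> ('o, 'm, 'p, 'n) fctr \<Rightarrow> ('p, 'n, 'o, 'm) fctr \<Rightarrow> bool" where
  "left_adjoint C D F G \<longleftrightarrow>
     is_functor C D F \<and> is_functor D C G \<and>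
     (\<exists>\<Phi>. (\<forall>A\<in>cat_ob C. \<forall>B\<in>cat_ob D.
             bij_betw (\<Phi> A B) (cat_hom D (fob F A) B) (cat_hom C A (fob G B))) \<and>
          (\<forall>A\<in>cat_ob C. \<forall>A'\<in>cat_ob C. \<forall>B\<in>cat_ob D. \<forall>B'\<in>cat_ob D.
             \<forall>u\<in>cat_hom C A' A. \<forall>v\<in>cat_hom D B B'. \<forall>f\<in>cat_hom D (fob F A) B.
             \<Phi> A' B' (cat_comp D (fob F A') B B' v
               (cat_comp D (fob F A') (fob F A) B f (fmap F A' A u))) =
             cat_comp C A' (fob G B) (fob G B') (fmap G B B' v)
               (cat_comp C A' A (fob G B) (\<Phi> A B f) u)))"

record ('o, 'm) monoidal_structure =
  mtensor :: "('o \<times> 'o, 'm \<times> 'm, 'o, 'm) fctr"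
  munit :: 'o
  massoc :: "'o \<Rightarrow> 'o \<Rightarrow> 'o \<Rightarrow> 'm"
  mlunit :: "'o \<Rightarrow> 'm"
  mrunit :: "'o \<Rightarrow> 'm"
  mbraid :: "'o \<Rightarrow> 'o \<Rightarrow> 'm"

definition tensor_ob :: "('o, 'm) monoidal_structure \<Rightarrow> 'o \<Rightarrow> 'o \<Rightarrow> 'o" where
  "tensor_ob T A B = fob (mtensor T) (A, B)"

definition tensor_mor ::
  "('o, 'm) monoidal_structure \<Rightarrow> 'o \<Rightarrow> 'o \<Rightarrow> 'o \<Rightarrow> 'o \<Rightarrow> 'm \<Rightarrow> 'm \<Rightarrow> 'm" where
  "tensor_mor T A B A' B' f g = fmap (mtensor T) (A, B) (A', B') (f, g)"

definition tensor_with ::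
  "('o, 'm) cat \<Rightarrow> ('o, 'm) monoidal_structure \<Rightarrow> 'o \<Rightarrow> ('o, 'm, 'o, 'm) fctr" where
  "tensor_with C T A = \<lparr>fob = tensor_ob T A,
     fmap = (\<lambda>B B'. tensor_mor T A B A B' (cat_id C A))\<rparr>"

definition symmetric_monoidal_category ::
  "('o, 'm) cat \<Rightarrow> ('o, 'm) monoidal_structure \<Rightarrow> bool" where
  "symmetric_monoidal_category C T \<longleftrightarrow>
     (let t = tensor_ob T; m = tensor_mor T; I = munit T; i = cat_id C;
          a = massoc T; l = mlunit T; r = mrunit T; s = mbraid T in
       category C \<and> is_functor (prod_cat C C) C (mtensor T) \<and> I \<in> cat_ob C \<and>
       natural_iso (prod_cat (prod_cat C C) C) C
         \<lparr>fob = (\<lambda>((A, B), D). t (t A B) D),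
          fmap = (\<lambda>((A, B), D) ((A', B'), D') ((f, g), h).
            m (t A B) D (t A' B') D' (m A B A' B' f g) h)\<rparr>
         \<lparr>fob = (\<lambda>((A, B), D). t A (t B D)),
          fmap = (\<lambda>((A, B), D) ((A', B'), D') ((f, g), h).
            m A (t B D) A' (t B' D') f (m B D B' D' g h))\<rparr>
         (\<lambda>((A, B), D). a A B D) \<and>
       natural_iso C C
         \<lparr>fob = (\<lambda>A. t I A), fmap = (\<lambda>A A' f. m I A I A' (i I) f)\<rparr>
         \<lparr>fob = (\<lambda>A. A), fmap = (\<lambda>A A' f. f)\<rparr> l \<and>
       natural_iso C C
         \<lparr>fob = (\<lambda>A. t A I), fmap = (\<lambda>A A' f. m A I A' I f (i I))\<rparr>
         \<lparr>fob = (\<lambda>A. A), fmap = (\<lambda>A A' f. f)\<rparr> r \<and>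
       natural_iso (prod_cat C C) C
         (mtensor T)
         \<lparr>fob = (\<lambda>(A, B). t B A), fmap = (\<lambda>(A, B) (A', B') (f, g). m B A B' A' g f)\<rparr>
         (\<lambda>(A, B). s A B) \<and>
       (\<forall>A\<in>cat_ob C. \<forall>B\<in>cat_ob C. \<forall>D\<in>cat_ob C. \<forall>E\<in>cat_ob C.
          cat_comp C (t (t (t A B) D) E) (t (t A B) (t D E)) (t A (t B (t D E)))
            (a A B (t D E)) (a (t A B) D E) =
          cat_comp C (t (t (t A B) D) E) (t A (t (t B D) E)) (t A (t B (t D E)))
            (m A (t (t B D) E) A (t B (t D E)) (i A) (a B D E))
            (cat_comp C (t (t (t A B) D) E) (t (t A (t B D)) E) (t A (t (t B D) E))
              (a A (t B D) E)
              (m (t (t A B) D) E (t A (t B D)) E (a A B D) (i E)))) \<and>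
       (\<forall>A\<in>cat_ob C. \<forall>B\<in>cat_ob C.
          cat_comp C (t (t A I) B) (t A (t I B)) (t A B)
            (m A (t I B) A B (i A) (l B)) (a A I B) =
          m (t A I) B A B (r A) (i B)) \<and>
       (\<forall>A\<in>cat_ob C. \<forall>B\<in>cat_ob C. \<forall>D\<in>cat_ob C.
          cat_comp C (t (t A B) D) (t (t B D) A) (t B (t D A))
            (a B D A)
            (cat_comp C (t (t A B) D) (t A (t B D)) (t (t B D) A)
              (s A (t B D)) (a A B D)) =
          cat_comp C (t (t A B) D) (t B (t A D)) (t B (t D A))
            (m B (t A D) B (t D A) (i B) (s A D))
            (cat_comp C (t (t A B) D) (t (t B A) D) (t B (t A D))
              (a B A D) (m (t A B) D (t B A) D (s A B) (i D)))) \<and>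
       (\<forall>A\<in>cat_ob C. \<forall>B\<in>cat_ob C.
          cat_comp C (t A B) (t B A) (t A B) (s B A) (s A B) = i (t A B)))"

definition closed_symmetric_monoidal_category ::
  "('o, 'm) cat \<Rightarrow> ('o, 'm) monoidal_structure \<Rightarrow> bool" where
  "closed_symmetric_monoidal_category C T \<longleftrightarrow>
     symmetric_monoidal_category C T \<and>
     (\<forall>A\<in>cat_ob C. \<exists>G. left_adjoint C C (tensor_with C T A) G)"


section \<open>The category of integral connectivity spaces of a universe of sets\<close>

text \<open>The objects of a category have to live in one HOL type, which must then contain the
  carriers of tensor products and internal homs. So \<open>Cnct\<close> is formed relative to a universe:
  a type \<open>'u\<close> with a collection of subsets (the small sets) that contains, up to the codings
  \<open>upair\<close> of pairs and \<open>ufun\<close> of functions, binary products and function sets. The elements of a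
  Grothendieck universe, with the usual set-theoretic pairs and graphs, form an example.\<close>

record 'u universe =
  small :: "'u set set"
  upt :: 'u
  upair :: "'u \<times> 'u \<Rightarrow> 'u"
  ufun :: "('u \<Rightarrow> 'u) \<Rightarrow> 'u"

definition is_universe :: "'u universe \<Rightarrow> bool" where
  "is_universe V \<longleftrightarrow>
     {upt V} \<in> small V \<and>
     (\<forall>A\<in>small V. \<forall>B. B \<subseteq> A \<longrightarrow> B \<in> small V) \<and>
     inj (upair V) \<and>
     (\<forall>A\<in>small V. \<forall>B\<in>small V. upair V ` (A \<times> B) \<in> small V) \<and>
     (\<forall>A\<in>small V. \<forall>B\<in>small V.
        inj_on (ufun V) (A \<rightarrow>\<^sub>E B) \<and> ufun V ` (A \<rightarrow>\<^sub>E B) \<in> small V)"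

definition Cnct :: "'u universe \<Rightarrow> ('u cspace, 'u \<Rightarrow> 'u) cat" where
  "Cnct V = \<lparr>cat_ob = {X. integral_cspace X \<and> points X \<in> small V},
     cat_hom = chom,
     cat_comp = (\<lambda>X Y Z g f. compose (points X) g f),
     cat_id = cid\<rparr>"

definition push :: "('a \<Rightarrow> 'b) \<Rightarrow> 'a cspace \<Rightarrow> 'b cspace" where
  "push e X = \<lparr>points = e ` points X, conn = (\<lambda>K. e ` K) ` conn X\<rparr>"

definition utensor :: "'u universe \<Rightarrow> 'u cspace \<Rightarrow> 'u cspace \<Rightarrow> 'u cspace" where
  "utensor V X Y = push (upair V) (X \<boxtimes> Y)"

definition uihom :: "'u universe \<Rightarrow> 'u cspace \<Rightarrow> 'u cspace \<Rightarrow> 'u cspace" where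
  "uihom V X Y = push (ufun V) (ihom X Y)"

definition ufst :: "'u universe \<Rightarrow> 'u \<Rightarrow> 'u" where
  "ufst V w = fst (inv (upair V) w)"

definition usnd :: "'u universe \<Rightarrow> 'u \<Rightarrow> 'u" where
  "usnd V w = snd (inv (upair V) w)"

definition tensor_left_functor ::
  "'u universe \<Rightarrow> 'u cspace \<Rightarrow> ('u cspace, 'u \<Rightarrow> 'u, 'u cspace, 'u \<Rightarrow> 'u) fctr" where
  "tensor_left_functor V X = \<lparr>fob = utensor V X,
     fmap = (\<lambda>Y Y' g. \<lambda>w\<in>points (utensor V X Y). upair V (ufst V w, g (usnd V w)))\<rparr>"

definition ihom_functor ::
  "'u universe \<Rightarrow> 'u cspace \<Rightarrow> ('u cspace, 'u \<Rightarrow> 'u, 'u cspace, 'u \<Rightarrow> 'u) fctr" where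
  "ihom_functor V X = \<lparr>fob = uihom V X,
     fmap = (\<lambda>Y Y' g. \<lambda>c\<in>points (uihom V X Y).
       ufun V (compose (points X) g (the_inv_into (chom X Y) (ufun V) c)))\<rparr>"

definition Cnct_tensor :: "'u universe \<Rightarrow> ('u cspace, 'u \<Rightarrow> 'u) monoidal_structure" where
  "Cnct_tensor V = \<lparr>
     mtensor = \<lparr>fob = (\<lambda>(X, Y). utensor V X Y),
       fmap = (\<lambda>(X, Y) (X', Y') (f, g).
         \<lambda>w\<in>points (utensor V X Y). upair V (f (ufst V w), g (usnd V w)))\<rparr>,
     munit = point_cspace (upt V),
     massoc = (\<lambda>X Y Z. \<lambda>w\<in>points (utensor V (utensor V X Y) Z).
       upair V (ufst V (ufst V w), upair V (usnd V (ufst V w), usnd V w))),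
     mlunit = (\<lambda>X. \<lambda>w\<in>points (utensor V (point_cspace (upt V)) X). usnd V w),
     mrunit = (\<lambda>X. \<lambda>w\<in>points (utensor V X (point_cspace (upt V))). ufst V w),
     mbraid = (\<lambda>X Y. \<lambda>w\<in>points (utensor V X Y). upair V (usnd V w, ufst V w))\<rparr>"

end

theory Submission
  imports Defs
begin

text \<open>The sets with connected image under a set-valued map with nonempty values form a connectivity
  structure. Hence connectedness of images out of \<open>X \<boxtimes> Y\<close>, or out of an iterated tensor product,
  need only be checked on rectangles; this yields the morphisms of the symmetric monoidal
  structure. For the adjunction, the union of the images of \<open>K\<close> under the maps \<open>f (-, y)\<close>, for
  \<open>y\<close> in \<open>L\<close>, is \<open>f ` (K \<times> L)\<close>, so that transposition matches
  the connectivity structure of the internal hom with that of the tensor product. In a universe,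
  everything is transported along the injective codings of pairs and functions.\<close>


text \<open>Connected sets of a tensor product are only known through generation, and in
  \<open>(X \<boxtimes> Y) \<boxtimes> Z\<close> even the generators \<open>C \<times> M\<close>
  contain a connected set \<open>C\<close> that is itself only generated. Set-valued maps resolve
  this: with \<open>M\<close> fixed, sending \<open>p\<close> to the image of
  \<open>{p} \<times> M\<close> is a map out of \<open>X \<boxtimes> Y\<close> whose values are
  nonempty as soon as \<open>M\<close> is, so the same principle reduces \<open>C\<close> to
  rectangles. Nonempty values matter because a point common to several sets has to yield a point
  common to their images. Integrality enters through rectangles with one side a singleton: slices of
  a morphism out of \<open>X \<boxtimes> Y\<close> are morphisms because points of \<open>Y\<close>
  are connected, and the unitors have morphisms as inverses because the point of the unit is
  connected. The coherence equations concern underlying functions and are checked pointwise, over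
  arbitrary types and again in a universe; what is transported along the codings are the morphisms
  and the bijection of the adjunction.\<close>

section \<open>Connectivity spaces, their morphisms and composition\<close>

lemma points_tensor [simp]: "points (X \<boxtimes> Y) = points X \<times> points Y"
  by (simp add: tensor_def)

lemma points_ihom [simp]: "points (ihom X Y) = chom X Y"
  by (simp add: ihom_def)

lemma points_push [simp]: "points (push e X) = e ` points X"
  by (simp add: push_def)

lemma conn_push [simp]: "conn (push e X) = (\<lambda>K. e ` K) ` conn X"
  by (simp add: push_def)

lemma points_point_cspace [simp]: "points (point_cspace p) = {p}"
  by (simp add: point_cspace_def)

lemma conn_point_cspace [simp]: "conn (point_cspace p) = {{}, {p}}"
  by (simp add: point_cspace_def)

lemma integral_point_cspace: "integral_cspace (point_cspace p)"
proof -
  have "\<Union>\<I> \<in> {{}, {p}}" if "\<I> \<subseteq> {{}, {p}}" for \<I>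
    using that by blast
  then show ?thesis
    by (auto simp: integral_cspace_def connectivity_space_def connectivity_structure_def)
qed

lemma integral_connectivity_space: "integral_cspace X \<Longrightarrow> connectivity_space X"
  by (simp add: integral_cspace_def)

lemma conn_subset: "connectivity_space X \<Longrightarrow> K \<in> conn X \<Longrightarrow> K \<subseteq> points X"
  by (auto simp: connectivity_space_def connectivity_structure_def)

lemma empty_conn: "connectivity_space X \<Longrightarrow> {} \<in> conn X"
  by (auto simp: connectivity_space_def connectivity_structure_def)

lemma Union_conn:
  "connectivity_space X \<Longrightarrow> \<I> \<subseteq> conn X \<Longrightarrow> \<Inter>\<I> \<noteq> {} \<Longrightarrow> \<Union>\<I> \<in> conn X"
  by (auto simp: connectivity_space_def connectivity_structure_def)

lemma singleton_conn: "integral_cspace X \<Longrightarrow> x \<in> points X \<Longrightarrow> {x} \<in> conn X"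
  by (simp add: integral_cspace_def)

lemma chomI:
  "f \<in> points X \<rightarrow>\<^sub>E points Y \<Longrightarrow> (\<And>K. K \<in> conn X \<Longrightarrow> f ` K \<in> conn Y) \<Longrightarrow> f \<in> chom X Y"
  by (simp add: chom_def)

lemma chom_PiE: "f \<in> chom X Y \<Longrightarrow> f \<in> points X \<rightarrow>\<^sub>E points Y"
  by (simp add: chom_def)

lemma chom_extensional: "f \<in> chom X Y \<Longrightarrow> f \<in> extensional (points X)"
  by (auto simp: chom_def PiE_def)

lemma chom_points: "f \<in> chom X Y \<Longrightarrow> x \<in> points X \<Longrightarrow> f x \<in> points Y"
  by (auto simp: chom_def)

lemma chom_conn: "f \<in> chom X Y \<Longrightarrow> K \<in> conn X \<Longrightarrow> f ` K \<in> conn Y"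
  by (simp add: chom_def)

text \<open>Connected sets lie in the carrier, so restricting does not change their images. Maps
  given by a formula become morphisms this way, with the image condition checked on the bare
  formula.\<close>

lemma chom_restrictI:
  assumes "connectivity_space X"
    and "\<And>x. x \<in> points X \<Longrightarrow> f x \<in> points Y"
    and "\<And>K. K \<in> conn X \<Longrightarrow> f ` K \<in> conn Y"
  shows "restrict f (points X) \<in> chom X Y"
proof (rule chomI)
  fix K assume K: "K \<in> conn X"
  then have "restrict f (points X) ` K = f ` K"
    using conn_subset[OF assms(1) K] by (intro image_cong) auto
  then show "restrict f (points X) ` K \<in> conn Y"
    using assms(3)[OF K] by simp
qed (use assms(2) in auto)

lemma cid_apply [simp]: "x \<in> points X \<Longrightarrow> cid X x = x"
  by (simp add: cid_def)

lemma cid_chom: "connectivity_space X \<Longrightarrow> cid X \<in> chom X X"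
  unfolding cid_def by (rule chom_restrictI) auto

lemma compose_chom:
  assumes "connectivity_space X" "f \<in> chom X Y" "g \<in> chom Y Z"
  shows "compose (points X) g f \<in> chom X Z"
proof -
  have "(\<lambda>x. g (f x)) ` K \<in> conn Z" if "K \<in> conn X" for K
    using chom_conn[OF assms(3) chom_conn[OF assms(2) that]] by (simp add: image_image)
  then show ?thesis
    unfolding compose_def by (intro chom_restrictI assms) (auto intro: chom_points assms)
qed

lemma compose_cid_right: "f \<in> chom X Y \<Longrightarrow> compose (points X) f (cid X) = f"
  by (rule extensionalityI[of _ "points X"]) (auto simp: compose_eq chom_extensional)

lemma compose_cid_left: "f \<in> chom X Y \<Longrightarrow> compose (points X) (cid Y) f = f"
  by (rule extensionalityI[of _ "points X"]) (auto simp: compose_eq chom_extensional chom_points)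

lemma compose_compose:
  "f \<in> chom X Y \<Longrightarrow>
   compose (points X) h (compose (points X) g f) = compose (points X) (compose (points Y) h g) f"
  by (rule extensionalityI[of _ "points X"]) (auto simp: compose_eq chom_points)

lemma category_laws:
  assumes "connectivity_space W"
  shows "cnct_category_laws W X Y Z"
  unfolding cnct_category_laws_def
  using assms
  by (auto simp: cid_chom compose_cid_left compose_cid_right compose_chom compose_compose)

lemma cisoI:
  assumes "f \<in> chom X Y" "g \<in> chom Y X"
    and "\<And>x. x \<in> points X \<Longrightarrow> g (f x) = x" "\<And>y. y \<in> points Y \<Longrightarrow> f (g y) = y"
  shows "ciso X Y f"
proof -
  have "compose (points X) g f = cid X" "compose (points Y) f g = cid Y"
    using assms(3,4) by (auto simp: compose_def cid_def)
  then show ?thesis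
    using assms(1,2) unfolding ciso_def by blast
qed


subsection \<open>Universal property of the tensor product\<close>

text \<open>If \<open>x\<close> is common to a family of sets, then any element of
  \<open>G x\<close> is common to their images, so the union of the images is connected in
  \<open>Z\<close>. Hence the sets with connected image are closed under the unions that define a
  connectivity structure, and contain everything generated by \<open>\<A>\<close>.\<close>

lemma UN_generated_conn:
  assumes Z: "connectivity_space Z" and A: "\<A> \<subseteq> Pow S"
    and G: "\<And>x. x \<in> S \<Longrightarrow> G x \<noteq> {}"
    and AG: "\<And>B. B \<in> \<A> \<Longrightarrow> (\<Union>x\<in>B. G x) \<in> conn Z"
    and C: "C \<in> generated S \<A>"
  shows "(\<Union>x\<in>C. G x) \<in> conn Z"
proof -
  let ?K = "{C. C \<subseteq> S \<and> (\<Union>x\<in>C. G x) \<in> conn Z}"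
  have "\<Union>\<I> \<in> ?K" if I: "\<I> \<subseteq> ?K" "\<Inter>\<I> \<noteq> {}" for \<I>
  \<comment> \<open>The empty family has intersection \<open>UNIV\<close>, so a point of the
    intersection need not lie in \<open>S\<close>, where \<open>G\<close> is known to be
    nonempty.\<close>
  proof (cases "\<I> = {}")
    case True
    then show ?thesis using empty_conn[OF Z] by simp
  next
    case False
    let ?J = "(\<lambda>C. \<Union>x\<in>C. G x) ` \<I>"
    obtain x where x: "x \<in> \<Inter>\<I>" using I(2) by blast
    with False I(1) have "x \<in> S" by blast
    then obtain z where "z \<in> G x" using G by blast
    with x have "z \<in> \<Inter>?J" by blast
    then have "\<Union>?J \<in> conn Z" using I(1) by (intro Union_conn[OF Z]) blast+
    moreover have "(\<Union>x\<in>\<Union>\<I>. G x) = \<Union>?J" by blast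
    ultimately have "(\<Union>x\<in>\<Union>\<I>. G x) \<in> conn Z" by (simp only:)
    moreover have "\<Union>\<I> \<subseteq> S" using I(1) by blast
    ultimately show ?thesis by blast
  qed
  then have "connectivity_structure S ?K"
    unfolding connectivity_structure_def using empty_conn[OF Z] by simp blast
  then have "generated S \<A> \<subseteq> ?K"
    by (rule generated_least) (use A AG in auto)
  then show ?thesis using C by blast
qed

lemma rectangles_subset:
  "connectivity_space X \<Longrightarrow> connectivity_space Y \<Longrightarrow>
   {K \<times> L | K L. K \<in> conn X \<and> L \<in> conn Y} \<subseteq> Pow (points X \<times> points Y)"
  by (auto dest: conn_subset)

lemma connectivity_space_tensor:
  assumes "connectivity_space X" "connectivity_space Y"
  shows "connectivity_space (X \<boxtimes> Y)"
  unfolding connectivity_space_def tensor_def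
  using connectivity_structure_generated[OF rectangles_subset[OF assms]] by simp

lemma rectangle_conn: "K \<in> conn X \<Longrightarrow> L \<in> conn Y \<Longrightarrow> K \<times> L \<in> conn (X \<boxtimes> Y)"
  using generated_superset[of "{K \<times> L | K L. K \<in> conn X \<and> L \<in> conn Y}" "points X \<times> points Y"]
  unfolding tensor_def by auto

lemma integral_tensor:
  assumes "integral_cspace X" "integral_cspace Y"
  shows "integral_cspace (X \<boxtimes> Y)"
proof -
  have "{(x, y)} \<in> conn (X \<boxtimes> Y)" if "x \<in> points X" "y \<in> points Y" for x y
    using rectangle_conn[of "{x}" X "{y}" Y] assms that by (simp add: singleton_conn)
  then show ?thesis
    using assms unfolding integral_cspace_def by (auto intro: connectivity_space_tensor)
qed

lemma UN_tensor_conn: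
  assumes "connectivity_space X" "connectivity_space Y" "connectivity_space Z"
    and "\<And>x y. x \<in> points X \<Longrightarrow> y \<in> points Y \<Longrightarrow> G (x, y) \<noteq> {}"
    and "\<And>K L. K \<in> conn X \<Longrightarrow> L \<in> conn Y \<Longrightarrow> (\<Union>p\<in>K \<times> L. G p) \<in> conn Z"
    and "C \<in> conn (X \<boxtimes> Y)"
  shows "(\<Union>p\<in>C. G p) \<in> conn Z"
proof (rule UN_generated_conn[OF assms(3) rectangles_subset[OF assms(1,2)]])
  show "C \<in> generated (points X \<times> points Y) {K \<times> L | K L. K \<in> conn X \<and> L \<in> conn Y}"
    using assms(6) by (simp add: tensor_def)
qed (use assms(4,5) in blast)+

lemma image_tensor_conn:
  assumes "connectivity_space X" "connectivity_space Y" "connectivity_space Z"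
    and "\<And>K L. K \<in> conn X \<Longrightarrow> L \<in> conn Y \<Longrightarrow> h ` (K \<times> L) \<in> conn Z"
    and "C \<in> conn (X \<boxtimes> Y)"
  shows "h ` C \<in> conn Z"
  using UN_tensor_conn[OF assms(1-3) _ _ assms(5), of "\<lambda>p. {h p}"] assms(4)
  by (simp add: UNION_singleton_eq_range)

text \<open>Serves maps out of \<open>(X \<boxtimes> Y) \<boxtimes> Z\<close>, whose generators are
  \<open>C \<times> M\<close> with \<open>C\<close> merely connected in
  \<open>X \<boxtimes> Y\<close>. The set-valued map sending \<open>p\<close> to the image of
  \<open>{p} \<times> M\<close> reduces \<open>C\<close> to rectangles; its values are nonempty
  exactly when \<open>M\<close> is, whence the case distinction.\<close>

lemma image_tensor_conn_times:
  assumes "connectivity_space X" "connectivity_space Y" "connectivity_space Z"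
    and "\<And>K L. K \<in> conn X \<Longrightarrow> L \<in> conn Y \<Longrightarrow> h ` ((K \<times> L) \<times> M) \<in> conn Z"
    and "C \<in> conn (X \<boxtimes> Y)"
  shows "h ` (C \<times> M) \<in> conn Z"
proof (cases "M = {}")
  case True
  then show ?thesis using empty_conn[OF assms(3)] by simp
next
  case False
  have eq: "(\<Union>p\<in>D. h ` ({p} \<times> M)) = h ` (D \<times> M)" for D by blast
  show ?thesis
    using UN_tensor_conn[OF assms(1-3) _ _ assms(5), of "\<lambda>p. h ` ({p} \<times> M)"] assms(4) False
    by (simp add: eq)
qed

text \<open>The mirror image, for maps out of
  \<open>X \<boxtimes> (Y \<boxtimes> Z)\<close>.\<close>

lemma image_times_tensor_conn:
  assumes "connectivity_space X" "connectivity_space Y" "connectivity_space Z"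
    and "\<And>K L. K \<in> conn X \<Longrightarrow> L \<in> conn Y \<Longrightarrow> h ` (M \<times> (K \<times> L)) \<in> conn Z"
    and "C \<in> conn (X \<boxtimes> Y)"
  shows "h ` (M \<times> C) \<in> conn Z"
proof (cases "M = {}")
  case True
  then show ?thesis using empty_conn[OF assms(3)] by simp
next
  case False
  have eq: "(\<Union>p\<in>D. h ` (M \<times> {p})) = h ` (M \<times> D)" for D by blast
  show ?thesis
    using UN_tensor_conn[OF assms(1-3) _ _ assms(5), of "\<lambda>p. h ` (M \<times> {p})"] assms(4) False
    by (simp add: eq)
qed

lemma tensor_chomI:
  assumes "connectivity_space X" "connectivity_space Y" "connectivity_space Z"
    and "\<And>x y. x \<in> points X \<Longrightarrow> y \<in> points Y \<Longrightarrow> h (x, y) \<in> points Z"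
    and "\<And>K L. K \<in> conn X \<Longrightarrow> L \<in> conn Y \<Longrightarrow> h ` (K \<times> L) \<in> conn Z"
  shows "restrict h (points X \<times> points Y) \<in> chom (X \<boxtimes> Y) Z"
  using chom_restrictI[OF connectivity_space_tensor[OF assms(1,2)], of h Z]
    image_tensor_conn[OF assms(1-3), of h] assms(4,5) by auto

section \<open>Functoriality, associativity, symmetry and units of the tensor product\<close>

lemma tensor_map_chom:
  assumes "connectivity_space X" "connectivity_space Y" "connectivity_space X'" "connectivity_space Y'"
    and "f \<in> chom X X'" "g \<in> chom Y Y'"
  shows "tensor_map X Y f g \<in> chom (X \<boxtimes> Y) (X' \<boxtimes> Y')"
proof -
  have "(\<lambda>(x, y). (f x, g y)) ` (K \<times> L) \<in> conn (X' \<boxtimes> Y')" if "K \<in> conn X" "L \<in> conn Y" for K L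
    using rectangle_conn[OF chom_conn[OF assms(5) that(1)] chom_conn[OF assms(6) that(2)]]
    by (metis map_prod_def map_prod_surj_on)
  then show ?thesis
    unfolding tensor_map_def using assms
    by (intro tensor_chomI connectivity_space_tensor) (auto intro: chom_points)
qed

lemma associator_chom:
  assumes "connectivity_space X" "connectivity_space Y" "connectivity_space Z"
  shows "associator X Y Z \<in> chom ((X \<boxtimes> Y) \<boxtimes> Z) (X \<boxtimes> (Y \<boxtimes> Z))"
proof -
  have "(\<lambda>((x, y), z). (x, y, z)) ` ((K \<times> L) \<times> M) \<in> conn (X \<boxtimes> (Y \<boxtimes> Z))"
    if "K \<in> conn X" "L \<in> conn Y" "M \<in> conn Z" for K L M
  proof -
    have "(\<lambda>((x, y), z). (x, y, z)) ` ((K \<times> L) \<times> M) = K \<times> L \<times> M" by force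
    then show ?thesis using that by (simp add: rectangle_conn)
  qed
  then show ?thesis
    unfolding associator_def points_tensor[of "X \<boxtimes> Y" Z] using assms
    by (intro tensor_chomI) (auto intro: connectivity_space_tensor image_tensor_conn_times[of X Y])
qed

text \<open>Inverse of \<open>associator\<close>. It has to be shown to be a morphism in its own
  right, since a bijective morphism of connectivity spaces need not be an isomorphism.\<close>

definition coassociator ::
  "'a cspace \<Rightarrow> 'b cspace \<Rightarrow> 'c cspace \<Rightarrow> 'a \<times> 'b \<times> 'c \<Rightarrow> ('a \<times> 'b) \<times> 'c" where
  "coassociator X Y Z = (\<lambda>(x, y, z)\<in>points (X \<boxtimes> Y \<boxtimes> Z). ((x, y), z))"

lemma coassociator_chom:
  assumes "connectivity_space X" "connectivity_space Y" "connectivity_space Z"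
  shows "coassociator X Y Z \<in> chom (X \<boxtimes> (Y \<boxtimes> Z)) ((X \<boxtimes> Y) \<boxtimes> Z)"
proof -
  have "(\<lambda>(x, y, z). ((x, y), z)) ` (K \<times> (L \<times> M)) \<in> conn ((X \<boxtimes> Y) \<boxtimes> Z)"
    if "K \<in> conn X" "L \<in> conn Y" "M \<in> conn Z" for K L M
  proof -
    have "(\<lambda>(x, y, z). ((x, y), z)) ` (K \<times> (L \<times> M)) = (K \<times> L) \<times> M" by force
    then show ?thesis using that by (simp add: rectangle_conn)
  qed
  then show ?thesis
    unfolding coassociator_def points_tensor[of X "Y \<boxtimes> Z"] using assms
    by (intro tensor_chomI) (auto intro: connectivity_space_tensor image_times_tensor_conn[of Y Z])
qed

lemma braiding_chom:
  assumes "connectivity_space X" "connectivity_space Y"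
  shows "braiding X Y \<in> chom (X \<boxtimes> Y) (Y \<boxtimes> X)"
proof -
  have "(\<lambda>(x, y). (y, x)) ` (K \<times> L) \<in> conn (Y \<boxtimes> X)" if "K \<in> conn X" "L \<in> conn Y" for K L
    using rectangle_conn[OF that(2,1)] product_swap[of K L]
    by (simp add: prod.swap_def case_prod_unfold)
  then show ?thesis
    unfolding braiding_def points_tensor using assms
    by (intro tensor_chomI connectivity_space_tensor) auto
qed

text \<open>A rectangle projects onto its second side unless its first side is empty, and then onto
  the empty set. The point \<open>p\<close> is arbitrary because the unit has the point
  \<open>()\<close> over arbitrary types and \<open>upt V\<close> in a universe.\<close>

lemma snd_chom:
  assumes "connectivity_space X"
  shows "(\<lambda>(u, x)\<in>{p} \<times> points X. x) \<in> chom (point_cspace p \<boxtimes> X) X"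
proof -
  have "(\<lambda>(u, x). x) ` (K \<times> L) \<in> conn X" if "K \<in> conn (point_cspace p)" "L \<in> conn X" for K L
  proof (cases "K = {}")
    case True
    then show ?thesis using empty_conn[OF assms] by simp
  next
    case False
    then have "(\<lambda>(u, x). x) ` (K \<times> L) = L" by force
    then show ?thesis using that by simp
  qed
  then show ?thesis
    using tensor_chomI[of "point_cspace p" X X "\<lambda>(u, x). x"] assms
    by (auto simp: integral_point_cspace integral_connectivity_space)
qed

lemma fst_chom:
  assumes "connectivity_space X"
  shows "(\<lambda>(x, u)\<in>points X \<times> {p}. x) \<in> chom (X \<boxtimes> point_cspace p) X"
proof -
  have "(\<lambda>(x, u). x) ` (K \<times> L) \<in> conn X" if "K \<in> conn X" "L \<in> conn (point_cspace p)" for K L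
  proof (cases "L = {}")
    case True
    then show ?thesis using empty_conn[OF assms] by simp
  next
    case False
    then have "(\<lambda>(x, u). x) ` (K \<times> L) = K" by force
    then show ?thesis using that by simp
  qed
  then show ?thesis
    using tensor_chomI[of X "point_cspace p" X "\<lambda>(x, u). x"] assms
    by (auto simp: integral_point_cspace integral_connectivity_space)
qed

text \<open>Since \<open>U\<close> is integral, \<open>{p}\<close> is connected and
  \<open>{p} \<times> K\<close> is a rectangle. With \<open>U\<close> the unit this map is the
  inverse of the left unitor.\<close>

lemma pair_left_chom:
  assumes "integral_cspace X" "p \<in> points U" "integral_cspace U"
  shows "(\<lambda>x\<in>points X. (p, x)) \<in> chom X (U \<boxtimes> X)"
proof (rule chom_restrictI)
  fix K assume "K \<in> conn X"
  moreover have "(\<lambda>x. (p, x)) ` K = {p} \<times> K" by auto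
  ultimately show "(\<lambda>x. (p, x)) ` K \<in> conn (U \<boxtimes> X)"
    using assms by (simp add: rectangle_conn singleton_conn)
qed (use assms in \<open>auto simp: integral_connectivity_space\<close>)

lemma pair_right_chom:
  assumes "integral_cspace X" "p \<in> points U" "integral_cspace U"
  shows "(\<lambda>x\<in>points X. (x, p)) \<in> chom X (X \<boxtimes> U)"
proof (rule chom_restrictI)
  fix K assume "K \<in> conn X"
  moreover have "(\<lambda>x. (x, p)) ` K = K \<times> {p}" by auto
  ultimately show "(\<lambda>x. (x, p)) ` K \<in> conn (X \<boxtimes> U)"
    using assms by (simp add: rectangle_conn singleton_conn)
qed (use assms in \<open>auto simp: integral_connectivity_space\<close>)


subsection \<open>Internal hom and the adjunction\<close>

text \<open>Let \<open>f\<close> belong to every member of the family and let \<open>x\<close> be a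
  point of \<open>K\<close>. Then \<open>f x\<close> belongs to the image of \<open>K\<close> under
  every member, so these images have connected union in \<open>Y\<close>.\<close>

lemma connectivity_space_ihom:
  assumes "connectivity_space X" "connectivity_space Y"
  shows "connectivity_space (ihom X Y)"
proof -
  have "(\<Union>f\<in>\<Union>\<I>. f ` K) \<in> conn Y"
    if I: "\<I> \<subseteq> conn (ihom X Y)" "\<Inter>\<I> \<noteq> {}" and K: "K \<in> conn X" for \<I> K
  proof (cases "K = {} \<or> \<I> = {}")
    case True
    then show ?thesis using empty_conn[OF assms(2)] by auto
  next
    case False
    then obtain x where "x \<in> K" by blast
    let ?J = "(\<lambda>M. \<Union>f\<in>M. f ` K) ` \<I>"
    have "\<Inter>?J \<noteq> {}" using I(2) \<open>x \<in> K\<close> by blast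
    moreover have "?J \<subseteq> conn Y" using I(1) K by (auto simp: ihom_def)
    ultimately have "\<Union>?J \<in> conn Y" by (intro Union_conn[OF assms(2)])
    moreover have "(\<Union>f\<in>\<Union>\<I>. f ` K) = \<Union>?J" by blast
    ultimately show ?thesis by (simp only:)
  qed
  moreover have "conn (ihom X Y) \<subseteq> Pow (chom X Y)" "{} \<in> conn (ihom X Y)"
    using empty_conn[OF assms(2)] by (auto simp: ihom_def)
  moreover have "\<Union>\<I> \<in> conn (ihom X Y)" if "\<I> \<subseteq> conn (ihom X Y)" "\<Inter>\<I> \<noteq> {}" for \<I>
  proof -
    have "\<Union>\<I> \<subseteq> chom X Y" using that(1) calculation(2) by blast
    with calculation(1)[OF that] show ?thesis by (simp add: ihom_def)
  qed
  ultimately show ?thesis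
    unfolding connectivity_space_def connectivity_structure_def by simp
qed

text \<open>Connectedness of \<open>{f}\<close> in the internal hom says that \<open>f\<close>
  preserves connected sets, which is part of being a morphism.\<close>

lemma integral_ihom:
  "connectivity_space X \<Longrightarrow> connectivity_space Y \<Longrightarrow> integral_cspace (ihom X Y)"
  unfolding integral_cspace_def
  by (simp add: connectivity_space_ihom) (simp add: ihom_def chom_conn)

text \<open>The union of the images of \<open>K\<close> under the composites of \<open>g\<close>
  with members of \<open>M\<close> is the image under \<open>g\<close> of the union for
  \<open>M\<close>.\<close>

lemma ihom_map_chom:
  assumes "connectivity_space X" "connectivity_space Y" "connectivity_space Y'" "g \<in> chom Y Y'"
  shows "ihom_map X Y g \<in> chom (ihom X Y) (ihom X Y')"
proof -
  have "compose (points X) g ` M \<in> conn (ihom X Y')" if M: "M \<in> conn (ihom X Y)" for M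
  proof -
    have "(\<Union>f\<in>compose (points X) g ` M. f ` K) \<in> conn Y'" if K: "K \<in> conn X" for K
    proof -
      have "compose (points X) g f ` K = g ` f ` K" for f
        using conn_subset[OF assms(1) K] by (auto simp: compose_def image_image intro!: image_cong)
      then have "(\<Union>f\<in>compose (points X) g ` M. f ` K) = g ` (\<Union>f\<in>M. f ` K)" by auto
      then show ?thesis
        using M K chom_conn[OF assms(4)] by (simp add: ihom_def)
    qed
    then show ?thesis
      using M compose_chom[OF assms(1) _ assms(4)] by (auto simp: ihom_def)
  qed
  then show ?thesis
    using chom_restrictI[OF connectivity_space_ihom[OF assms(1,2)], of "compose (points X) g"]
      compose_chom[OF assms(1) _ assms(4)]
    by (simp add: ihom_map_def)
qed

lemma transpose_chom:
  assumes "connectivity_space X" "integral_cspace Y" "f \<in> chom (X \<boxtimes> Y) Z"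
  shows "transpose X Y f \<in> chom Y (ihom X Z)"
proof -
  have img: "f ` (K \<times> L) \<in> conn Z" if "K \<in> conn X" "L \<in> conn Y" for K L
    using chom_conn[OF assms(3) rectangle_conn[OF that]] .
  \<comment> \<open>Integrality of \<open>Y\<close> makes \<open>{y}\<close> connected, so that
    \<open>K \<times> {y}\<close> is a rectangle.\<close>
  have curry: "(\<lambda>x\<in>points X. f (x, y)) \<in> chom X Z" if y: "y \<in> points Y" for y
  proof (rule chom_restrictI[OF assms(1)])
    fix K assume "K \<in> conn X"
    moreover have "(\<lambda>x. f (x, y)) ` K = f ` (K \<times> {y})" by auto
    ultimately show "(\<lambda>x. f (x, y)) ` K \<in> conn Z"
      using img singleton_conn[OF assms(2) y] by simp
  qed (use chom_points[OF assms(3)] y in auto)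
  show ?thesis
    unfolding transpose_def
  proof (rule chom_restrictI)
    fix L assume L: "L \<in> conn Y"
    let ?M = "(\<lambda>y. \<lambda>x\<in>points X. f (x, y)) ` L"
    have "(\<Union>\<phi>\<in>?M. \<phi> ` K) \<in> conn Z" if K: "K \<in> conn X" for K
    proof -
      have "(\<lambda>x\<in>points X. f (x, y)) ` K = f ` (K \<times> {y})" for y
        using conn_subset[OF assms(1) K] by force
      then have "(\<Union>\<phi>\<in>?M. \<phi> ` K) = f ` (K \<times> L)" by auto
      then show ?thesis using img[OF K L] by simp
    qed
    moreover have "L \<subseteq> points Y"
      using L assms(2) by (simp add: conn_subset integral_connectivity_space)
    ultimately show "?M \<in> conn (ihom X Z)"
      using curry by (auto simp: ihom_def)
  qed (use assms curry in \<open>auto simp: integral_connectivity_space\<close>)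
qed

text \<open>Connectedness of the image of \<open>L\<close> in the internal hom, tested on
  \<open>K\<close>, is connectedness of the image of the rectangle \<open>K \<times> L\<close>;
  rectangles suffice for maps out of the tensor product.\<close>

lemma uncurry_chom:
  assumes "connectivity_space X" "connectivity_space Y" "connectivity_space Z"
    and "g \<in> chom Y (ihom X Z)"
  shows "(\<lambda>(x, y)\<in>points X \<times> points Y. g y x) \<in> chom (X \<boxtimes> Y) Z"
proof (rule tensor_chomI)
  fix K L assume "K \<in> conn X" "L \<in> conn Y"
  moreover have "(\<lambda>(x, y). g y x) ` (K \<times> L) = (\<Union>\<phi>\<in>g ` L. \<phi> ` K)" by auto
  ultimately show "(\<lambda>(x, y). g y x) ` (K \<times> L) \<in> conn Z"
    using chom_conn[OF assms(4)] by (simp add: ihom_def)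
next
  fix x y assume "x \<in> points X" "y \<in> points Y"
  then show "(case (x, y) of (x, y) \<Rightarrow> g y x) \<in> points Z"
    using chom_points[OF assms(4), of y] by (auto intro: chom_points)
qed (use assms in auto)

lemma bij_betw_transpose:
  assumes "connectivity_space X" "integral_cspace Y" "connectivity_space Z"
  shows "bij_betw (transpose X Y) (chom (X \<boxtimes> Y) Z) (chom Y (ihom X Z))"
proof (rule bij_betwI)
  let ?u = "\<lambda>g. \<lambda>(x, y)\<in>points X \<times> points Y. g y x"
  have Y: "connectivity_space Y" using assms(2) by (rule integral_connectivity_space)
  show "transpose X Y \<in> chom (X \<boxtimes> Y) Z \<rightarrow> chom Y (ihom X Z)"
    using transpose_chom[OF assms(1,2)] by blast
  show "?u \<in> chom Y (ihom X Z) \<rightarrow> chom (X \<boxtimes> Y) Z"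
    using uncurry_chom[OF assms(1) Y assms(3)] by blast
  show "?u (transpose X Y f) = f" if "f \<in> chom (X \<boxtimes> Y) Z" for f
    using chom_extensional[OF that]
    by (intro extensionalityI[of _ "points X \<times> points Y"]) (auto simp: transpose_def)
  show "transpose X Y (?u g) = g" if g: "g \<in> chom Y (ihom X Z)" for g
  proof (rule extensionalityI[of _ "points Y"])
    fix y assume y: "y \<in> points Y"
    \<comment> \<open>Equality with \<open>g\<close> needs extensionality in both arguments: that of
      \<open>g\<close> itself, and that of each value \<open>g y\<close>, which is a
      morphism.\<close>
    have "g y \<in> extensional (points X)"
      using chom_points[OF g y] by (simp add: chom_extensional)
    then show "transpose X Y (?u g) y = g y"
      using y by (intro extensionalityI[of _ "points X"]) (auto simp: transpose_def)
  qed (use chom_extensional[OF g] in \<open>auto simp: transpose_def\<close>)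
qed



subsection \<open>The laws over arbitrary types\<close>

text \<open>Reduces the naturality and coherence equations, whose sides are restricted functions, to
  equations between values at points of the carrier.\<close>

lemma restrict_eq_iff: "restrict f A = restrict g A \<longleftrightarrow> (\<forall>x\<in>A. f x = g x)"
  by (metis restrict_apply' restrict_ext)

lemma cid_tensor: "cid (X \<boxtimes> Y) = (\<lambda>(x, y)\<in>points X \<times> points Y. (x, y))"
  by (auto simp: cid_def)

lemma tensor_left_eq_tensor_map: "tensor_left X Y g = tensor_map X Y (cid X) g"
  by (auto simp: tensor_left_def tensor_map_def)

lemma tensor_functor_laws:
  assumes "integral_cspace X" "connectivity_space X'" "integral_cspace Y" "connectivity_space Y'"
  shows "tensor_functor_laws X X' X'' Y Y' Y''"
  unfolding tensor_functor_laws_def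
proof (intro conjI ballI)
  show "tensor_map X Y (cid X) (cid Y) = cid (X \<boxtimes> Y)"
    by (auto simp: tensor_map_def cid_tensor)
  fix f f' g g' assume "f \<in> chom X X'" "f' \<in> chom X' X''" "g \<in> chom Y Y'" "g' \<in> chom Y' Y''"
  then show "tensor_map X Y (compose (points X) f' f) (compose (points Y) g' g) =
      compose (points (X \<boxtimes> Y)) (tensor_map X' Y' f' g') (tensor_map X Y f g)"
    by (auto simp: tensor_map_def compose_def restrict_eq_iff dest: chom_points)
qed (use assms in \<open>auto intro: integral_tensor tensor_map_chom integral_connectivity_space\<close>)

text \<open>These are the laws of the tensor product in two variables with \<open>cid X\<close> in
  the first; the composition law uses that \<open>cid X\<close> composed with itself is
  \<open>cid X\<close>.\<close>

lemma tensor_left_functor_laws: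
  assumes "integral_cspace X" "integral_cspace Y" "connectivity_space Y'"
  shows "tensor_left_functor_laws X Y Y' Y''"
proof -
  have X: "connectivity_space X" using assms(1) by (rule integral_connectivity_space)
  have "tensor_functor_laws X X X Y Y' Y''"
    using assms X by (intro tensor_functor_laws)
  then show ?thesis
    using cid_chom[OF X] compose_cid_left[OF cid_chom[OF X]]
    unfolding tensor_functor_laws_def tensor_left_functor_laws_def tensor_left_eq_tensor_map
    by metis
qed

lemma ihom_functor_laws:
  assumes "connectivity_space X" "connectivity_space Y" "connectivity_space Y'"
  shows "ihom_functor_laws X Y Y' Y''"
  unfolding ihom_functor_laws_def
proof (intro conjI ballI)
  show "ihom_map X Y (cid Y) = cid (ihom X Y)"
    by (auto simp: ihom_map_def cid_def[of "ihom X Y"] restrict_eq_iff compose_cid_left)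
  fix g g' assume "g \<in> chom Y Y'" "g' \<in> chom Y' Y''"
  then show "ihom_map X Y (compose (points Y) g' g) =
      compose (points (ihom X Y)) (ihom_map X Y' g') (ihom_map X Y g)"
    using compose_chom[OF assms(1)]
    by (auto simp: ihom_map_def compose_def[of "chom X Y"] restrict_eq_iff compose_compose)
qed (use assms in \<open>auto intro: integral_ihom ihom_map_chom\<close>)

lemma tensor_ihom_adjunction:
  assumes "connectivity_space X" "integral_cspace Y" "connectivity_space Z"
  shows "tensor_ihom_adjunction X Y Y' Z Z'"
  unfolding tensor_ihom_adjunction_def
proof (intro conjI ballI)
  show "bij_betw (transpose X Y) (chom (X \<boxtimes> Y) Z) (chom Y (ihom X Z))"
    by (rule bij_betw_transpose[OF assms])
  fix g h f assume g: "g \<in> chom Y' Y" and h: "h \<in> chom Z Z'" and f: "f \<in> chom (X \<boxtimes> Y) Z"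
  \<comment> \<open>\<open>ihom_map X Z h\<close> is meaningful only on \<open>chom X Z\<close>, so
    the slice must be known to be a morphism. Both sides then send \<open>y\<close> to the function
    \<open>x \<mapsto> h (f (x, g y))\<close>.\<close>
  have "(\<lambda>x\<in>points X. f (x, g y)) \<in> chom X Z" if "y \<in> points Y'" for y
    using chom_points[OF transpose_chom[OF assms(1,2) f] chom_points[OF g that]]
    by (simp add: transpose_def chom_points[OF g that])
  then show "transpose X Y' (compose (points (X \<boxtimes> Y')) h
        (compose (points (X \<boxtimes> Y')) f (tensor_left X Y' g))) =
      compose (points Y') (ihom_map X Z h) (compose (points Y') (transpose X Y f) g)"
    using chom_points[OF g]
    by (auto simp: transpose_def compose_def ihom_map_def tensor_left_def restrict_eq_iff)
qed

lemma associator_laws: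
  assumes "connectivity_space X" "connectivity_space Y" "connectivity_space Z"
  shows "associator_laws X X' Y Y' Z Z'"
  unfolding associator_laws_def
proof (intro conjI ballI)
  show "ciso ((X \<boxtimes> Y) \<boxtimes> Z) (X \<boxtimes> (Y \<boxtimes> Z)) (associator X Y Z)"
    by (rule cisoI[OF associator_chom[OF assms] coassociator_chom[OF assms]])
      (auto simp: associator_def coassociator_def)
  fix f g h assume "f \<in> chom X X'" "g \<in> chom Y Y'" "h \<in> chom Z Z'"
  then show "compose (points ((X \<boxtimes> Y) \<boxtimes> Z)) (associator X' Y' Z')
        (tensor_map (X \<boxtimes> Y) Z (tensor_map X Y f g) h) =
      compose (points ((X \<boxtimes> Y) \<boxtimes> Z)) (tensor_map X (Y \<boxtimes> Z) f (tensor_map Y Z g h))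
        (associator X Y Z)"
    by (auto simp: associator_def tensor_map_def compose_def restrict_eq_iff dest: chom_points)
qed

lemma unitor_laws:
  assumes "integral_cspace X"
  shows "unitor_laws X X'"
proof -
  have X: "connectivity_space X" using assms by (rule integral_connectivity_space)
  have "ciso (one_cspace \<boxtimes> X) X (left_unitor X)"
    using snd_chom[OF X, of "()"] pair_left_chom[OF assms _ integral_point_cspace, of "()" "()"]
    by (intro cisoI[where g = "\<lambda>x\<in>points X. ((), x)"]) (auto simp: left_unitor_def)
  moreover have "ciso (X \<boxtimes> one_cspace) X (right_unitor X)"
    using fst_chom[OF X, of "()"] pair_right_chom[OF assms _ integral_point_cspace, of "()" "()"]
    by (intro cisoI[where g = "\<lambda>x\<in>points X. (x, ())"]) (auto simp: right_unitor_def)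
  ultimately show ?thesis
    unfolding unitor_laws_def
    by (auto simp: integral_point_cspace left_unitor_def right_unitor_def tensor_map_def
        compose_def restrict_eq_iff dest: chom_points)
qed

lemma braiding_laws:
  assumes "connectivity_space X" "connectivity_space Y"
  shows "braiding_laws X X' Y Y'"
  unfolding braiding_laws_def
proof (intro conjI ballI)
  show "ciso (X \<boxtimes> Y) (Y \<boxtimes> X) (braiding X Y)"
    by (rule cisoI[OF braiding_chom[OF assms] braiding_chom[OF assms(2,1)]])
      (auto simp: braiding_def)
  show "compose (points (X \<boxtimes> Y)) (braiding Y X) (braiding X Y) = cid (X \<boxtimes> Y)"
    by (auto simp: braiding_def compose_def cid_tensor restrict_eq_iff)
  fix f g assume "f \<in> chom X X'" "g \<in> chom Y Y'"
  then show "compose (points (X \<boxtimes> Y)) (braiding X' Y') (tensor_map X Y f g) =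
      compose (points (X \<boxtimes> Y)) (tensor_map Y X g f) (braiding X Y)"
    by (auto simp: braiding_def tensor_map_def compose_def restrict_eq_iff dest: chom_points)
qed

text \<open>Both sides send \<open>(((w, x), y), z)\<close> to \<open>(w, x, y, z)\<close>.\<close>

lemma pentagon_law: "pentagon_law W X Y Z"
  by (auto simp: pentagon_law_def associator_def tensor_map_def compose_def restrict_eq_iff Let_def)

lemma triangle_law: "triangle_law X Y"
  by (auto simp: triangle_law_def associator_def tensor_map_def left_unitor_def right_unitor_def
      compose_def restrict_eq_iff)

lemma hexagon_law: "hexagon_law X Y Z"
  by (auto simp: hexagon_law_def associator_def tensor_map_def braiding_def compose_def
      restrict_eq_iff Let_def)


subsection \<open>Transport along injections\<close>

text \<open>Injectivity is what lifts a common point: if \<open>z\<close> lies in the image of every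
  set of the family, its preimages in these sets are one and the same point, which is therefore
  common to the sets themselves.\<close>

lemma connectivity_space_push:
  assumes "connectivity_space X" "inj_on e (points X)"
  shows "connectivity_space (push e X)"
proof -
  have "\<Union>\<I> \<in> (`) e ` conn X" if I: "\<I> \<subseteq> (`) e ` conn X" "\<Inter>\<I> \<noteq> {}" for \<I>
  proof -
    obtain \<J> where J: "\<J> \<subseteq> conn X" "\<I> = (`) e ` \<J>" using I(1) by (auto simp: subset_image_iff)
    have "\<Inter>\<J> \<noteq> {}"
    proof (cases "\<J> = {}")
      case False
      then obtain K where K: "K \<in> \<J>" by blast
      obtain z where z: "\<forall>L\<in>\<J>. z \<in> e ` L" using I(2) J(2) by blast
      then obtain x where x: "x \<in> K" "z = e x" using K by blast
      have "x \<in> L" if L: "L \<in> \<J>" for L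
      proof -
        obtain x' where x': "x' \<in> L" "e x = e x'" using z L x(2) by blast
        moreover have "x \<in> points X" "x' \<in> points X"
          using conn_subset[OF assms(1)] J(1) K L x(1) x'(1) by blast+
        ultimately show ?thesis using inj_onD[OF assms(2)] by blast
      qed
      then show ?thesis by blast
    qed simp
    then have "\<Union>\<J> \<in> conn X" by (rule Union_conn[OF assms(1) J(1)])
    moreover have "\<Union>\<I> = e ` \<Union>\<J>" using J(2) by blast
    ultimately show ?thesis by blast
  qed
  moreover have "(`) e ` conn X \<subseteq> Pow (e ` points X)" "{} \<in> (`) e ` conn X"
    using conn_subset[OF assms(1)] empty_conn[OF assms(1)] by blast+
  ultimately show ?thesis
    unfolding connectivity_space_def connectivity_structure_def points_push conn_push by blast
qed

lemma integral_push:
  assumes "integral_cspace X" "inj_on e (points X)"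
  shows "integral_cspace (push e X)"
proof -
  have "{e x} \<in> (`) e ` conn X" if "x \<in> points X" for x
    using singleton_conn[OF assms(1) that] by (intro image_eqI[of _ _ "{x}"]) auto
  then show ?thesis
    using assms connectivity_space_push unfolding integral_cspace_def by auto
qed

lemma chom_from_push:
  assumes "connectivity_space X" "h \<in> chom X Y" "f \<in> extensional (e ` points X)"
    and "\<And>x. x \<in> points X \<Longrightarrow> f (e x) = h x"
  shows "f \<in> chom (push e X) Y"
proof (rule chomI)
  show "f \<in> points (push e X) \<rightarrow>\<^sub>E points Y"
    using assms(3,4) chom_points[OF assms(2)] by (auto simp: PiE_def)
  fix K' assume "K' \<in> conn (push e X)"
  then obtain K where K: "K \<in> conn X" "K' = e ` K" by auto
  then have "f ` K' = h ` K"
    using assms(4) conn_subset[OF assms(1) K(1)] by (force simp: image_image)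
  then show "f ` K' \<in> conn Y" using chom_conn[OF assms(2) K(1)] by simp
qed

lemma chom_to_push:
  assumes "connectivity_space X" "h \<in> chom X Y"
  shows "(\<lambda>x\<in>points X. e (h x)) \<in> chom X (push e Y)"
proof (rule chom_restrictI[OF assms(1)])
  fix K assume "K \<in> conn X"
  then have "e ` h ` K \<in> conn (push e Y)" using chom_conn[OF assms(2)] by auto
  then show "(\<lambda>x. e (h x)) ` K \<in> conn (push e Y)" by (simp add: image_image)
qed (use chom_points[OF assms(2)] in auto)

text \<open>The inverse decodes the argument with \<open>the_inv_into\<close>. Together with
  \<open>bij_betw_chom_to_push\<close> this carries the bijection of the adjunction over to coded
  spaces.\<close>

lemma bij_betw_chom_from_push:
  assumes "connectivity_space X" "inj_on e (points X)"
  shows "bij_betw (\<lambda>f. \<lambda>x\<in>points X. f (e x)) (chom (push e X) Y) (chom X Y)"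
proof (rule bij_betwI)
  let ?g = "\<lambda>h. \<lambda>w\<in>e ` points X. h (the_inv_into (points X) e w)"
  show "(\<lambda>f. \<lambda>x\<in>points X. f (e x)) \<in> chom (push e X) Y \<rightarrow> chom X Y"
  proof
    fix f assume f: "f \<in> chom (push e X) Y"
    show "(\<lambda>x\<in>points X. f (e x)) \<in> chom X Y"
    proof (rule chom_restrictI[OF assms(1)])
      fix K assume "K \<in> conn X"
      then have "f ` e ` K \<in> conn Y" using chom_conn[OF f] by simp
      then show "(\<lambda>x. f (e x)) ` K \<in> conn Y" by (simp add: image_image)
    qed (use chom_points[OF f] in simp)
  qed
  show "?g \<in> chom X Y \<rightarrow> chom (push e X) Y"
    by (auto intro!: chom_from_push[OF assms(1)] simp: the_inv_into_f_f[OF assms(2)])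
  show "?g (\<lambda>x\<in>points X. f (e x)) = f" if "f \<in> chom (push e X) Y" for f
    using chom_extensional[OF that]
    by (intro extensionalityI[of _ "e ` points X"]) (auto simp: the_inv_into_f_f[OF assms(2)])
  show "(\<lambda>x\<in>points X. ?g h (e x)) = h" if "h \<in> chom X Y" for h
    using chom_extensional[OF that]
    by (intro extensionalityI[of _ "points X"]) (auto simp: the_inv_into_f_f[OF assms(2)])
qed

lemma decode_chom:
  assumes "connectivity_space X" "inj_on e (points X)"
  shows "restrict (the_inv_into (points X) e) (e ` points X) \<in> chom (push e X) X"
  by (rule chom_from_push[OF assms(1) cid_chom[OF assms(1)]])
    (auto simp: the_inv_into_f_f[OF assms(2)])

text \<open>The inverse is composition with the decoding map, which is a morphism by
  \<open>decode_chom\<close>.\<close>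

lemma bij_betw_chom_to_push:
  assumes "connectivity_space X" "connectivity_space Y" "inj_on e (points Y)"
  shows "bij_betw (\<lambda>f. \<lambda>x\<in>points X. e (f x)) (chom X Y) (chom X (push e Y))"
proof (rule bij_betwI)
  let ?d = "restrict (the_inv_into (points Y) e) (e ` points Y)"
  show "(\<lambda>f. \<lambda>x\<in>points X. e (f x)) \<in> chom X Y \<rightarrow> chom X (push e Y)"
    using chom_to_push[OF assms(1)] by blast
  show "compose (points X) ?d \<in> chom X (push e Y) \<rightarrow> chom X Y"
    using compose_chom[OF assms(1) _ decode_chom[OF assms(2,3)]] by blast
  show "compose (points X) ?d (\<lambda>x\<in>points X. e (f x)) = f" if f: "f \<in> chom X Y" for f
    using chom_extensional[OF f] chom_points[OF f]
    by (intro extensionalityI[of _ "points X"])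
      (auto simp: compose_def the_inv_into_f_f[OF assms(3)])
  show "(\<lambda>x\<in>points X. e (compose (points X) ?d g x)) = g" if g: "g \<in> chom X (push e Y)" for g
    using chom_extensional[OF g] chom_points[OF g]
    by (intro extensionalityI[of _ "points X"])
      (auto simp: compose_def f_the_inv_into_f[OF assms(3)])
qed



subsection \<open>Categories of spaces in a universe\<close>

lemma Cnct_simps [simp]:
  "cat_ob (Cnct V) = {X. integral_cspace X \<and> points X \<in> small V}"
  "cat_hom (Cnct V) = chom"
  "cat_comp (Cnct V) X Y Z g f = compose (points X) g f"
  "cat_id (Cnct V) = cid"
  by (simp_all add: Cnct_def)

lemma cat_iso_Cnct [simp]: "cat_iso (Cnct V) = ciso"
  by (intro ext) (simp add: cat_iso_def ciso_def)

lemma category_Cnct: "category (Cnct V)"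
  unfolding category_def
  by (auto simp: integral_connectivity_space cid_chom compose_cid_left compose_cid_right
      compose_chom compose_compose)

lemma prod_cat_simps [simp]:
  "cat_ob (prod_cat C D) = cat_ob C \<times> cat_ob D"
  "cat_hom (prod_cat C D) (A, B) (A', B') = cat_hom C A A' \<times> cat_hom D B B'"
  "cat_comp (prod_cat C D) (A, B) (A', B') (A'', B'') (f', g') (f, g) =
     (cat_comp C A A' A'' f' f, cat_comp D B B' B'' g' g)"
  "cat_id (prod_cat C D) (A, B) = (cat_id C A, cat_id D B)"
  by (simp_all add: prod_cat_def)

lemma points_utensor [simp]: "points (utensor V X Y) = upair V ` (points X \<times> points Y)"
  by (simp add: utensor_def)

lemma points_uihom [simp]: "points (uihom V X Y) = ufun V ` chom X Y"
  by (simp add: uihom_def)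

text \<open>Lets a morphism obtained as a composite be replaced by a simpler formula with the same
  values.\<close>

lemma chom_cong:
  "g \<in> chom X Y \<Longrightarrow> f \<in> extensional (points X) \<Longrightarrow> (\<And>x. x \<in> points X \<Longrightarrow> f x = g x) \<Longrightarrow> f \<in> chom X Y"
  by (metis chom_extensional extensionalityI)

text \<open>Decoding, restricted to the coded carrier so that it can be a morphism;
  \<open>mkpair\<close> is its counterpart for coding. Morphisms between coded tensor products are
  built by placing uncoded ones between the two.\<close>

definition unpair :: "'u universe \<Rightarrow> 'u cspace \<Rightarrow> 'u cspace \<Rightarrow> 'u \<Rightarrow> 'u \<times> 'u" where
  "unpair V X Y = (\<lambda>w\<in>points (utensor V X Y). (ufst V w, usnd V w))"

definition mkpair :: "'u universe \<Rightarrow> 'u cspace \<Rightarrow> 'u cspace \<Rightarrow> 'u \<times> 'u \<Rightarrow> 'u" where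
  "mkpair V X Y = restrict (upair V) (points X \<times> points Y)"

definition utensor_map ::
  "'u universe \<Rightarrow> 'u cspace \<Rightarrow> 'u cspace \<Rightarrow> ('u \<Rightarrow> 'u) \<Rightarrow> ('u \<Rightarrow> 'u) \<Rightarrow> 'u \<Rightarrow> 'u" where
  "utensor_map V X Y f g = (\<lambda>w\<in>points (utensor V X Y). upair V (f (ufst V w), g (usnd V w)))"

definition utranspose ::
  "'u universe \<Rightarrow> 'u cspace \<Rightarrow> 'u cspace \<Rightarrow> ('u \<Rightarrow> 'u) \<Rightarrow> 'u \<Rightarrow> 'u" where
  "utranspose V X Y f = (\<lambda>y\<in>points Y. ufun V (\<lambda>x\<in>points X. f (upair V (x, y))))"

lemma Cnct_tensor_simps:
  "mtensor (Cnct_tensor V) = \<lparr>fob = (\<lambda>(X, Y). utensor V X Y),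
     fmap = (\<lambda>(X, Y) (X', Y') (f, g). utensor_map V X Y f g)\<rparr>"
  "munit (Cnct_tensor V) = point_cspace (upt V)"
  "massoc (Cnct_tensor V) X Y Z = (\<lambda>w\<in>points (utensor V (utensor V X Y) Z).
     upair V (ufst V (ufst V w), upair V (usnd V (ufst V w), usnd V w)))"
  "mlunit (Cnct_tensor V) X = (\<lambda>w\<in>points (utensor V (point_cspace (upt V)) X). usnd V w)"
  "mrunit (Cnct_tensor V) X = (\<lambda>w\<in>points (utensor V X (point_cspace (upt V))). ufst V w)"
  "mbraid (Cnct_tensor V) X Y = (\<lambda>w\<in>points (utensor V X Y). upair V (usnd V w, ufst V w))"
  by (simp_all add: Cnct_tensor_def utensor_map_def)

lemma tensor_ob_Cnct: "tensor_ob (Cnct_tensor V) = utensor V"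
  by (intro ext) (simp add: tensor_ob_def Cnct_tensor_simps)

lemma tensor_mor_Cnct: "tensor_mor (Cnct_tensor V) X Y X' Y' = utensor_map V X Y"
  by (intro ext) (simp add: tensor_mor_def Cnct_tensor_simps)

section \<open>Codings of pairs and functions in a fixed universe\<close>

context
  fixes V :: "'u universe"
  assumes V: "is_universe V"
begin

lemma upair_inj: "inj (upair V)"
  using V by (simp add: is_universe_def)

lemma ufst_upair [simp]: "ufst V (upair V (x, y)) = x"
  by (simp add: ufst_def inv_f_f[OF upair_inj])

lemma usnd_upair [simp]: "usnd V (upair V (x, y)) = y"
  by (simp add: usnd_def inv_f_f[OF upair_inj])

lemma upair_mem_iff [simp]: "upair V p \<in> upair V ` A \<longleftrightarrow> p \<in> A"
  by (rule inj_image_mem_iff[OF upair_inj])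

lemma small_subset: "A \<in> small V \<Longrightarrow> B \<subseteq> A \<Longrightarrow> B \<in> small V"
  using V by (simp add: is_universe_def)

lemma small_upair: "A \<in> small V \<Longrightarrow> B \<in> small V \<Longrightarrow> upair V ` (A \<times> B) \<in> small V"
  using V by (simp add: is_universe_def)

lemma inj_on_ufun:
  assumes "points X \<in> small V" "points Y \<in> small V"
  shows "inj_on (ufun V) (chom X Y)"
proof (rule inj_on_subset)
  show "inj_on (ufun V) (points X \<rightarrow>\<^sub>E points Y)"
    using V assms by (simp add: is_universe_def)
  show "chom X Y \<subseteq> points X \<rightarrow>\<^sub>E points Y"
    using chom_PiE by blast
qed

lemma small_ufun:
  assumes "points X \<in> small V" "points Y \<in> small V"
  shows "ufun V ` chom X Y \<in> small V"
proof (rule small_subset)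
  show "ufun V ` (points X \<rightarrow>\<^sub>E points Y) \<in> small V"
    using V assms by (simp add: is_universe_def)
  show "ufun V ` chom X Y \<subseteq> ufun V ` (points X \<rightarrow>\<^sub>E points Y)"
    using chom_PiE by (intro image_mono) blast
qed

lemma small_upt: "{upt V} \<in> small V"
  using V by (simp add: is_universe_def)

lemma inj_on_upair: "inj_on (upair V) A"
  using upair_inj by (rule inj_on_subset) simp

lemma integral_utensor:
  "integral_cspace X \<Longrightarrow> integral_cspace Y \<Longrightarrow> integral_cspace (utensor V X Y)"
  unfolding utensor_def by (intro integral_push integral_tensor inj_on_upair)

lemma connectivity_space_utensor:
  "connectivity_space X \<Longrightarrow> connectivity_space Y \<Longrightarrow> connectivity_space (utensor V X Y)"
  unfolding utensor_def by (intro connectivity_space_push connectivity_space_tensor inj_on_upair)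

lemma integral_uihom:
  assumes "connectivity_space X" "connectivity_space Y" "points X \<in> small V" "points Y \<in> small V"
  shows "integral_cspace (uihom V X Y)"
  unfolding uihom_def using assms by (intro integral_push integral_ihom) (auto intro: inj_on_ufun)

text \<open>On codes of pairs \<open>unpair\<close> acts as the identity of
  \<open>X \<boxtimes> Y\<close>.\<close>

lemma unpair_chom:
  assumes "connectivity_space X" "connectivity_space Y"
  shows "unpair V X Y \<in> chom (utensor V X Y) (X \<boxtimes> Y)"
  unfolding utensor_def
  by (rule chom_from_push[OF _ cid_chom]) (auto simp: unpair_def assms connectivity_space_tensor)

lemma mkpair_chom:
  assumes "connectivity_space X" "connectivity_space Y"
  shows "mkpair V X Y \<in> chom (X \<boxtimes> Y) (utensor V X Y)"
proof -
  have "(\<lambda>p\<in>points (X \<boxtimes> Y). upair V (cid (X \<boxtimes> Y) p)) \<in> chom (X \<boxtimes> Y) (utensor V X Y)"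
    unfolding utensor_def using assms
    by (intro chom_to_push connectivity_space_tensor cid_chom)
  then show ?thesis
    by (rule chom_cong) (auto simp: mkpair_def)
qed

lemma chom_from_utensor:
  assumes "connectivity_space X" "connectivity_space Y" "h \<in> chom (X \<boxtimes> Y) Z"
    and "f \<in> extensional (upair V ` (points X \<times> points Y))"
    and "\<And>x y. x \<in> points X \<Longrightarrow> y \<in> points Y \<Longrightarrow> f (upair V (x, y)) = h (x, y)"
  shows "f \<in> chom (utensor V X Y) Z"
  unfolding utensor_def
  by (rule chom_from_push[OF connectivity_space_tensor[OF assms(1,2)] assms(3)])
    (use assms(4,5) in auto)

section \<open>Structure morphisms between coded tensor products\<close>

lemma utensor_map_chom:
  assumes "connectivity_space X" "connectivity_space Y" "connectivity_space X'" "connectivity_space Y'"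
    and "f \<in> chom X X'" "g \<in> chom Y Y'"
  shows "utensor_map V X Y f g \<in> chom (utensor V X Y) (utensor V X' Y')"
proof (rule chom_from_utensor[OF assms(1,2)])
  show "compose (points (X \<boxtimes> Y)) (mkpair V X' Y') (tensor_map X Y f g)
      \<in> chom (X \<boxtimes> Y) (utensor V X' Y')"
    using assms by (intro compose_chom[OF _ tensor_map_chom mkpair_chom] connectivity_space_tensor)
qed (auto simp: utensor_map_def mkpair_def tensor_map_def compose_def
    chom_points[OF assms(5)] chom_points[OF assms(6)])

text \<open>Once the outer pair is decoded, the map is a chain of morphisms: decode the inner pair
  with \<open>unpair\<close>, reassociate, code the new inner pair, code the outer pair.\<close>

lemma massoc_chom:
  assumes "connectivity_space X" "connectivity_space Y" "connectivity_space Z"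
  shows "massoc (Cnct_tensor V) X Y Z
    \<in> chom (utensor V (utensor V X Y) Z) (utensor V X (utensor V Y Z))"
proof (rule chom_from_utensor)
  let ?S = "points (utensor V X Y \<boxtimes> Z)"
  show "compose ?S (mkpair V X (utensor V Y Z)) (compose ?S
      (tensor_map X (Y \<boxtimes> Z) (cid X) (mkpair V Y Z)) (compose ?S (associator X Y Z)
      (tensor_map (utensor V X Y) Z (unpair V X Y) (cid Z))))
    \<in> chom (utensor V X Y \<boxtimes> Z) (utensor V X (utensor V Y Z))"
    by (rule compose_chom[OF _ compose_chom[OF _ compose_chom[OF _ tensor_map_chom associator_chom]
          tensor_map_chom] mkpair_chom])
      (intro assms connectivity_space_tensor connectivity_space_utensor unpair_chom mkpair_chom
        cid_chom)+
qed (auto simp: assms connectivity_space_utensor Cnct_tensor_simps compose_def mkpair_def unpair_def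
    tensor_map_def associator_def)

definition mcoassoc :: "'u cspace \<Rightarrow> 'u cspace \<Rightarrow> 'u cspace \<Rightarrow> 'u \<Rightarrow> 'u" where
  "mcoassoc X Y Z = (\<lambda>w\<in>points (utensor V X (utensor V Y Z)).
     upair V (upair V (ufst V w, ufst V (usnd V w)), usnd V (usnd V w)))"

text \<open>The chain used for \<open>massoc\<close>, with the two bracketings exchanged.\<close>

lemma mcoassoc_chom:
  assumes "connectivity_space X" "connectivity_space Y" "connectivity_space Z"
  shows "mcoassoc X Y Z \<in> chom (utensor V X (utensor V Y Z)) (utensor V (utensor V X Y) Z)"
proof (rule chom_from_utensor)
  let ?S = "points (X \<boxtimes> utensor V Y Z)"
  show "compose ?S (mkpair V (utensor V X Y) Z) (compose ?S
      (tensor_map (X \<boxtimes> Y) Z (mkpair V X Y) (cid Z)) (compose ?S (coassociator X Y Z)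
      (tensor_map X (utensor V Y Z) (cid X) (unpair V Y Z))))
    \<in> chom (X \<boxtimes> utensor V Y Z) (utensor V (utensor V X Y) Z)"
    by (rule compose_chom[OF _ compose_chom[OF _ compose_chom[OF _ tensor_map_chom coassociator_chom]
          tensor_map_chom] mkpair_chom])
      (intro assms connectivity_space_tensor connectivity_space_utensor unpair_chom mkpair_chom
        cid_chom)+
qed (auto simp: assms connectivity_space_utensor mcoassoc_def compose_def mkpair_def unpair_def
    tensor_map_def coassociator_def)

lemma mbraid_chom:
  assumes "connectivity_space X" "connectivity_space Y"
  shows "mbraid (Cnct_tensor V) X Y \<in> chom (utensor V X Y) (utensor V Y X)"
proof (rule chom_from_utensor[OF assms])
  show "compose (points (X \<boxtimes> Y)) (mkpair V Y X) (braiding X Y) \<in> chom (X \<boxtimes> Y) (utensor V Y X)"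
    using assms by (intro compose_chom[OF _ braiding_chom mkpair_chom] connectivity_space_tensor)
qed (auto simp: Cnct_tensor_simps compose_def mkpair_def braiding_def)

lemma massoc_ciso:
  assumes "connectivity_space X" "connectivity_space Y" "connectivity_space Z"
  shows "ciso (utensor V (utensor V X Y) Z) (utensor V X (utensor V Y Z))
    (massoc (Cnct_tensor V) X Y Z)"
  by (rule cisoI[OF massoc_chom[OF assms] mcoassoc_chom[OF assms]])
    (auto simp: Cnct_tensor_simps mcoassoc_def)

lemma mbraid_ciso:
  assumes "connectivity_space X" "connectivity_space Y"
  shows "ciso (utensor V X Y) (utensor V Y X) (mbraid (Cnct_tensor V) X Y)"
  by (rule cisoI[OF mbraid_chom[OF assms] mbraid_chom[OF assms(2,1)]])
    (auto simp: Cnct_tensor_simps)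

lemma mlunit_ciso:
  assumes "integral_cspace X"
  shows "ciso (utensor V (point_cspace (upt V)) X) X (mlunit (Cnct_tensor V) X)"
proof (rule cisoI)
  let ?U = "point_cspace (upt V)"
  have X: "connectivity_space X" and U: "connectivity_space ?U"
    by (fact integral_connectivity_space[OF assms] integral_connectivity_space[OF integral_point_cspace])+
  show "mlunit (Cnct_tensor V) X \<in> chom (utensor V ?U X) X"
    by (rule chom_from_utensor[OF U X snd_chom[OF X]]) (auto simp: Cnct_tensor_simps)
  \<comment> \<open>The inverse pairs \<open>x\<close> with the point of the unit and codes the
    result.\<close>
  show "compose (points X) (mkpair V ?U X) (\<lambda>x\<in>points X. (upt V, x)) \<in> chom X (utensor V ?U X)"
    using assms integral_point_cspace
    by (intro compose_chom[OF X pair_left_chom mkpair_chom[OF U X]]) auto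
qed (auto simp: Cnct_tensor_simps compose_def mkpair_def)

lemma mrunit_ciso:
  assumes "integral_cspace X"
  shows "ciso (utensor V X (point_cspace (upt V))) X (mrunit (Cnct_tensor V) X)"
proof (rule cisoI)
  let ?U = "point_cspace (upt V)"
  have X: "connectivity_space X" and U: "connectivity_space ?U"
    by (fact integral_connectivity_space[OF assms] integral_connectivity_space[OF integral_point_cspace])+
  show "mrunit (Cnct_tensor V) X \<in> chom (utensor V X ?U) X"
    by (rule chom_from_utensor[OF X U fst_chom[OF X]]) (auto simp: Cnct_tensor_simps)
  show "compose (points X) (mkpair V X ?U) (\<lambda>x\<in>points X. (x, upt V)) \<in> chom X (utensor V X ?U)"
    using assms integral_point_cspace
    by (intro compose_chom[OF X pair_right_chom mkpair_chom[OF X U]]) auto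
qed (auto simp: Cnct_tensor_simps compose_def mkpair_def)

lemma utensor_map_cid: "utensor_map V X Y (cid X) (cid Y) = cid (utensor V X Y)"
  by (auto simp: utensor_map_def cid_def[of "utensor V X Y"] restrict_eq_iff)

lemma utensor_map_compose:
  assumes "f \<in> chom X X'" "g \<in> chom Y Y'"
  shows "utensor_map V X Y (compose (points X) f' f) (compose (points Y) g' g) =
    compose (points (utensor V X Y)) (utensor_map V X' Y' f' g') (utensor_map V X Y f g)"
  using assms by (auto simp: utensor_map_def compose_def restrict_eq_iff dest: chom_points)

lemma is_functor_utensor: "is_functor (prod_cat (Cnct V) (Cnct V)) (Cnct V) (mtensor (Cnct_tensor V))"
  unfolding is_functor_def
  by (auto simp: Cnct_tensor_simps(1) integral_connectivity_space utensor_map_cid integral_utensor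
      small_upair utensor_map_compose simp del: points_utensor intro!: utensor_map_chom)
    (auto simp: small_upair)

lemma massoc_natural:
  assumes "f \<in> chom X X'" "g \<in> chom Y Y'" "h \<in> chom Z Z'"
  shows "compose (points (utensor V (utensor V X Y) Z)) (massoc (Cnct_tensor V) X' Y' Z')
      (utensor_map V (utensor V X Y) Z (utensor_map V X Y f g) h) =
    compose (points (utensor V (utensor V X Y) Z))
      (utensor_map V X (utensor V Y Z) f (utensor_map V Y Z g h)) (massoc (Cnct_tensor V) X Y Z)"
  using assms
  by (auto simp: Cnct_tensor_simps utensor_map_def compose_def restrict_eq_iff dest: chom_points)

lemma mlunit_natural:
  assumes "f \<in> chom X X'"
  shows "compose (points (utensor V (point_cspace (upt V)) X)) (mlunit (Cnct_tensor V) X')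
      (utensor_map V (point_cspace (upt V)) X (cid (point_cspace (upt V))) f) =
    compose (points (utensor V (point_cspace (upt V)) X)) f (mlunit (Cnct_tensor V) X)"
  using assms
  by (auto simp: Cnct_tensor_simps utensor_map_def compose_def restrict_eq_iff dest: chom_points)

lemma mrunit_natural:
  assumes "f \<in> chom X X'"
  shows "compose (points (utensor V X (point_cspace (upt V)))) (mrunit (Cnct_tensor V) X')
      (utensor_map V X (point_cspace (upt V)) f (cid (point_cspace (upt V)))) =
    compose (points (utensor V X (point_cspace (upt V)))) f (mrunit (Cnct_tensor V) X)"
  using assms
  by (auto simp: Cnct_tensor_simps utensor_map_def compose_def restrict_eq_iff dest: chom_points)

lemma mbraid_natural:
  assumes "f \<in> chom X X'" "g \<in> chom Y Y'"
  shows "compose (points (utensor V X Y)) (mbraid (Cnct_tensor V) X' Y') (utensor_map V X Y f g) =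
    compose (points (utensor V X Y)) (utensor_map V Y X g f) (mbraid (Cnct_tensor V) X Y)"
  using assms
  by (auto simp: Cnct_tensor_simps utensor_map_def compose_def restrict_eq_iff dest: chom_points)

lemma symmetric_monoidal_Cnct: "symmetric_monoidal_category (Cnct V) (Cnct_tensor V)"
  unfolding symmetric_monoidal_category_def Let_def tensor_ob_Cnct tensor_mor_Cnct
    Cnct_tensor_simps(2)
proof (intro conjI, goal_cases)
  case 1 show ?case by (rule category_Cnct)
next
  case 2 show ?case by (rule is_functor_utensor)
next
  case 3 show ?case by (simp add: integral_point_cspace small_upt)
next
  \<comment> \<open>Cases 4 to 7 are the natural isomorphisms: associator, left unitor, right
    unitor, braiding.\<close>
  case 4 show ?case
    unfolding natural_iso_def
    by (auto simp del: points_utensor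
        intro!: massoc_ciso massoc_natural integral_connectivity_space)
next
  case 5 show ?case
    unfolding natural_iso_def
    by (auto simp del: points_utensor intro!: mlunit_ciso mlunit_natural)
next
  case 6 show ?case
    unfolding natural_iso_def
    by (auto simp del: points_utensor intro!: mrunit_ciso mrunit_natural)
next
  case 7 show ?case
    unfolding natural_iso_def Cnct_tensor_simps(1)
    by (auto simp del: points_utensor
        intro!: mbraid_ciso mbraid_natural integral_connectivity_space)
next
  \<comment> \<open>Cases 8 to 11 are pentagon, triangle, hexagon and the involutivity of the
    braiding, evaluated on codes of tuples.\<close>
  case 8 show ?case
    by (auto simp: Cnct_tensor_simps utensor_map_def compose_def restrict_eq_iff)
next
  case 9 show ?case
    by (auto simp: Cnct_tensor_simps utensor_map_def compose_def restrict_eq_iff)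
next
  case 10 show ?case
    by (auto simp: Cnct_tensor_simps utensor_map_def compose_def restrict_eq_iff)
next
  case 11 show ?case
    by (auto simp: Cnct_tensor_simps compose_def restrict_eq_iff cid_def)
qed

section \<open>The two functors in a universe and their adjunction\<close>

text \<open>The abstract functor applies \<open>cid X\<close> to the first coordinate, the concrete
  one leaves it alone; they agree on codes of pairs from the carriers. This links closedness to the
  adjunction for the concrete functor.\<close>

lemma tensor_with_Cnct: "tensor_with (Cnct V) (Cnct_tensor V) X = tensor_left_functor V X"
  by (auto simp: tensor_with_def tensor_left_functor_def tensor_ob_Cnct tensor_mor_Cnct
      utensor_map_def fun_eq_iff restrict_def)

lemma fmap_tensor_left: "fmap (tensor_left_functor V X) Y Y' g = utensor_map V X Y (cid X) g"
  by (auto simp: tensor_left_functor_def utensor_map_def restrict_eq_iff)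

lemma fob_tensor_left: "fob (tensor_left_functor V X) = utensor V X"
  by (simp add: tensor_left_functor_def)

lemma is_functor_tensor_left:
  assumes "integral_cspace X" "points X \<in> small V"
  shows "is_functor (Cnct V) (Cnct V) (tensor_left_functor V X)"
proof -
  have X: "connectivity_space X" using assms(1) by (rule integral_connectivity_space)
  have "utensor_map V X Y (cid X) (compose (points Y) g' g) =
      compose (points (utensor V X Y)) (utensor_map V X Y' (cid X) g') (utensor_map V X Y (cid X) g)"
    if "g \<in> chom Y Y'" for Y Y' g g'
    using utensor_map_compose[OF cid_chom[OF X] that, of "cid X" g']
    by (simp add: compose_cid_left[OF cid_chom[OF X]])
  then show ?thesis
    unfolding is_functor_def fmap_tensor_left fob_tensor_left using assms X
    by (auto simp: integral_connectivity_space utensor_map_cid integral_utensor small_upair cid_chom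
        simp del: points_utensor intro!: utensor_map_chom)
      (auto simp: small_upair)
qed

text \<open>Pairs have a globally injective coding, whereas \<open>ufun V\<close> is only assumed
  injective on each function set between small sets. Functions are therefore decoded relative to a
  hom-set.\<close>

lemma decode_ufun:
  "points X \<in> small V \<Longrightarrow> points Y \<in> small V \<Longrightarrow> \<phi> \<in> chom X Y \<Longrightarrow>
   the_inv_into (chom X Y) (ufun V) (ufun V \<phi>) = \<phi>"
  by (intro the_inv_into_f_f inj_on_ufun)

lemma fob_ihom_functor: "fob (ihom_functor V X) = uihom V X"
  by (simp add: ihom_functor_def)

lemma fmap_ihom_functor:
  assumes "points X \<in> small V" "points Y \<in> small V" "\<phi> \<in> chom X Y"
  shows "fmap (ihom_functor V X) Y Y' g (ufun V \<phi>) = ufun V (compose (points X) g \<phi>)"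
  using assms by (simp add: ihom_functor_def decode_ufun)

lemma fmap_ihom_functor_extensional:
  "fmap (ihom_functor V X) Y Y' g \<in> extensional (ufun V ` chom X Y)"
  by (simp add: ihom_functor_def)

text \<open>On codes the map is \<open>ihom_map X Y g\<close> followed by coding.\<close>

lemma fmap_ihom_functor_chom:
  assumes "connectivity_space X" "connectivity_space Y" "connectivity_space Y'"
    and "points X \<in> small V" "points Y \<in> small V" "g \<in> chom Y Y'"
  shows "fmap (ihom_functor V X) Y Y' g \<in> chom (uihom V X Y) (uihom V X Y')"
  unfolding uihom_def
  by (rule chom_from_push[OF connectivity_space_ihom[OF assms(1,2)]
        chom_to_push[OF connectivity_space_ihom[OF assms(1,2)] ihom_map_chom[OF assms(1-3,6)]]])
    (auto simp: fmap_ihom_functor_extensional fmap_ihom_functor assms ihom_map_def)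

lemma is_functor_ihom:
  assumes X: "integral_cspace X" "points X \<in> small V"
  shows "is_functor (Cnct V) (Cnct V) (ihom_functor V X)"
proof -
  have X': "connectivity_space X" using X(1) by (rule integral_connectivity_space)
  have id: "fmap (ihom_functor V X) Y Y (cid Y) = cid (uihom V X Y)"
    if "points Y \<in> small V" for Y
    by (rule extensionalityI[OF fmap_ihom_functor_extensional])
      (auto simp: cid_def[of "uihom V X Y"] fmap_ihom_functor X that compose_cid_left)
  have comp: "fmap (ihom_functor V X) Y Y'' (compose (points Y) g' g) =
      compose (points (uihom V X Y)) (fmap (ihom_functor V X) Y' Y'' g') (fmap (ihom_functor V X) Y Y' g)"
    if "points Y \<in> small V" "points Y' \<in> small V" "g \<in> chom Y Y'" for Y Y' Y'' g g'
    by (rule extensionalityI[OF fmap_ihom_functor_extensional])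
      (auto simp: compose_def[of "ufun V ` _"] fmap_ihom_functor X that compose_compose
        compose_chom[OF X' _ that(3)])
  show ?thesis
    unfolding is_functor_def fob_ihom_functor
    using X X'
    by (auto simp: id comp integral_connectivity_space integral_uihom small_ufun
        simp del: points_uihom intro!: fmap_ihom_functor_chom)
      (auto simp: small_ufun)
qed

text \<open>A composite of three bijections: decode the source, transpose, code the values.
  Smallness of \<open>X\<close> and \<open>Z\<close> makes the coding of \<open>chom X Z\<close>
  injective.\<close>

lemma bij_betw_utranspose:
  assumes "connectivity_space X" "integral_cspace Y" "connectivity_space Z"
    and "points X \<in> small V" "points Z \<in> small V"
  shows "bij_betw (utranspose V X Y) (chom (utensor V X Y) Z) (chom Y (uihom V X Z))"
proof -
  have Y: "connectivity_space Y" using assms(2) by (rule integral_connectivity_space)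
  let ?a = "\<lambda>f. \<lambda>p\<in>points (X \<boxtimes> Y). f (upair V p)"
  let ?c = "\<lambda>f. \<lambda>y\<in>points Y. ufun V (f y)"
  have "bij_betw (?c \<circ> (transpose X Y \<circ> ?a)) (chom (utensor V X Y) Z) (chom Y (uihom V X Z))"
    unfolding utensor_def uihom_def
    by (rule bij_betw_trans[OF bij_betw_trans[OF bij_betw_chom_from_push bij_betw_transpose]
          bij_betw_chom_to_push])
      (auto simp: assms Y connectivity_space_tensor connectivity_space_ihom inj_on_upair inj_on_ufun)
  moreover have "?c \<circ> (transpose X Y \<circ> ?a) = utranspose V X Y"
    by (auto simp: fun_eq_iff utranspose_def transpose_def restrict_def intro!: arg_cong[of _ _ "ufun V"])
  ultimately show ?thesis by simp
qed

text \<open>Needed for naturality: the value of \<open>utranspose V X Y f\<close> at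
  \<open>y\<close> is the code of this slice, and it decodes correctly because the slice is a
  morphism.\<close>

lemma curry_utensor_chom:
  assumes "connectivity_space X" "integral_cspace Y" "f \<in> chom (utensor V X Y) Z" "y \<in> points Y"
  shows "(\<lambda>x\<in>points X. f (upair V (x, y))) \<in> chom X Z"
proof -
  have Y: "connectivity_space Y" using assms(2) by (rule integral_connectivity_space)
  have "compose (points (X \<boxtimes> Y)) f (mkpair V X Y) \<in> chom (X \<boxtimes> Y) Z"
    using assms(1,3) Y by (intro compose_chom[OF _ mkpair_chom] connectivity_space_tensor)
  then have "transpose X Y (compose (points (X \<boxtimes> Y)) f (mkpair V X Y)) y \<in> chom X Z"
    using chom_points[OF transpose_chom[OF assms(1,2)] assms(4)] by simp
  then show ?thesis
    by (rule chom_cong) (auto simp: transpose_def compose_def mkpair_def assms(4))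
qed

lemma left_adjoint_Cnct:
  assumes X: "integral_cspace X" "points X \<in> small V"
  shows "left_adjoint (Cnct V) (Cnct V) (tensor_left_functor V X) (ihom_functor V X)"
proof -
  have X': "connectivity_space X" using X(1) by (rule integral_connectivity_space)
  \<comment> \<open>Both sides send \<open>y\<close> to the code of the function
    \<open>x \<mapsto> v (f (upair V (x, u y)))\<close> on the carrier of \<open>X\<close>.\<close>
  have nat: "utranspose V X Y' (compose (points (utensor V X Y')) v
        (compose (points (utensor V X Y')) f (utensor_map V X Y' (cid X) u))) =
      compose (points Y') (fmap (ihom_functor V X) Z Z' v)
        (compose (points Y') (utranspose V X Y f) u)"
    if "integral_cspace Y" "points Z \<in> small V"
      "u \<in> chom Y' Y" "f \<in> chom (utensor V X Y) Z" for Y Y' Z Z' u v f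
    using curry_utensor_chom[OF X' that(1,4)] that(2) X(2) chom_points[OF that(3)]
    by (auto simp: utranspose_def compose_def restrict_eq_iff utensor_map_def fmap_ihom_functor
        intro!: arg_cong[of _ _ "ufun V"])
  show ?thesis
    unfolding left_adjoint_def fob_tensor_left fmap_tensor_left fob_ihom_functor
    using X X' is_functor_tensor_left[OF X] is_functor_ihom[OF X]
    by (intro conjI exI[of _ "\<lambda>Y _. utranspose V X Y"])
      (auto intro: bij_betw_utranspose integral_connectivity_space nat simp del: points_utensor)
qed

lemma closed_symmetric_monoidal_Cnct:
  "closed_symmetric_monoidal_category (Cnct V) (Cnct_tensor V)"
  unfolding closed_symmetric_monoidal_category_def tensor_with_Cnct
  using symmetric_monoidal_Cnct left_adjoint_Cnct by auto

end


theorem theorem13: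
  fixes W :: "'w cspace"
    and X :: "'x cspace" and X' :: "'x1 cspace" and X'' :: "'x2 cspace"
    and Y :: "'y cspace" and Y' :: "'y1 cspace" and Y'' :: "'y2 cspace"
    and Z :: "'z cspace" and Z' :: "'z1 cspace"
    and V :: "'u universe"
  assumes "integral_cspace W"
    and "integral_cspace X" and "integral_cspace X'" and "integral_cspace X''"
    and "integral_cspace Y" and "integral_cspace Y'" and "integral_cspace Y''"
    and "integral_cspace Z" and "integral_cspace Z'"
  shows
    "(cnct_category_laws W X Y Z \<and>
      tensor_left_functor_laws X Y Y' Y'' \<and>
      ihom_functor_laws X Y Y' Y'' \<and>
      tensor_ihom_adjunction X Y Y' Z Z' \<and>
      tensor_functor_laws X X' X'' Y Y' Y'' \<and>
      associator_laws X X' Y Y' Z Z' \<and>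
      unitor_laws X X' \<and>
      braiding_laws X X' Y Y' \<and>
      pentagon_law W X Y Z \<and>
      triangle_law X Y \<and>
      hexagon_law X Y Z) \<and>
     (is_universe V \<longrightarrow>
       (\<forall>A\<in>cat_ob (Cnct V).
          left_adjoint (Cnct V) (Cnct V) (tensor_left_functor V A) (ihom_functor V A)) \<and>
       closed_symmetric_monoidal_category (Cnct V) (Cnct_tensor V))"
proof -
  note cs = assms[THEN integral_connectivity_space]
  show ?thesis
    using closed_symmetric_monoidal_Cnct[of V] left_adjoint_Cnct[of V] assms cs
    by (simp add: category_laws tensor_left_functor_laws ihom_functor_laws tensor_ihom_adjunction
        tensor_functor_laws associator_laws unitor_laws braiding_laws pentagon_law triangle_law
        hexagon_law)
qed

end
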